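(* Let $r\geq 1$, let $F_1,\dots,F_r\in\mathbf{FQSym}$ be arbitrary, and let $H$ be an element of the Patras–Reutenauer algebra $\mathcal{A}\subset\mathbf{FQSym}$. Then the splitting formula $$(F_1F_2\cdots F_r)*H=\mu_r\left[(F_1\otimes\cdots\otimes F_r)*_r\Delta^rH\right]$$ holds.
   Context: $\mathbb{K}$ is a field of characteristic $0$ and $A=\{a_1<a_2<\cdots\}$ an infinite totally ordered alphabet of noncommuting letters. Standardization: for a word $w$ (with letters in a totally ordered set) of length $m$, $\mathrm{std}(w)\in\mathfrak{S}_m$ is obtained by labelling the occurrences of the smallest letter from left to right by $1,2,\dots$, then continuing with the occurrences of the next letter, and so on. For a permutation $\sigma$, $\mathbf{G}_\sigma=\sum_{\mathrm{std}(w)=\sigma}w$ and $\mathbf{F}_\sigma=\mathbf{G}_{\sigma^{-1}}$. $\mathbf{FQSym}$ is the Hopf algebra with linear basis $(\mathbf{G}_\sigma)$, $\sigma\in\bigsqcup_{n\ge0}\mathfrak{S}_n$, with the product induced from noncommutative power series, i.e. $\mathbf{G}_\alpha\mathbf{G}_\beta=\sum\mathbf{G}_\gamma$ over permutations $\gamma=u\cdot v$ with $\mathrm{std}(u)=\alpha$, $\mathrm{std}(v)=\beta$, and coproduct $\Delta\mathbf{F}_\sigma=\sum_{u\cdot v=\sigma}\mathbf{F}_{\mathrm{std}(u)}\otimes\mathbf{F}_{\mathrm{std}(v)}$ (sum over all factorizations of the word $\sigma$, including empty factors). The internal product $*$ on $\mathbf{FQSym}$ is the bilinear operation with $\mathbf{G}_\sigma*\mathbf{G}_\tau=\mathbf{G}_{\tau\sigma}$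 if $\sigma,\tau$ lie in the same symmetric group and $0$ otherwise, where $\tau\sigma$ is the usual product of the symmetric group, $(\tau\sigma)(i)=\tau(\sigma(i))$. $\mu_r:\mathbf{FQSym}^{\otimes r}\to\mathbf{FQSym}$ is the $r$-fold ordinary multiplication, $\Delta^r:\mathbf{FQSym}\to\mathbf{FQSym}^{\otimes r}$ is the iterated coproduct (with values in the $r$-fold tensor power), and $*_r$ is the operation induced by $*$ componentwise on $\mathbf{FQSym}^{\otimes r}$. Patras–Reutenauer algebra: for $j\ge1$, let $\mathrm{Lie}_j\subset\mathbb{K}[\mathfrak{S}_j]$ be the multilinear part of the free Lie algebra on the letters $1,\dots,j$ (permutations being identified with multilinear words), embedded in $\mathbf{FQSym}$ by $\sigma\mapsto\mathbf{G}_\sigma$. $\mathcal{A}=\bigoplus_n\mathcal{A}_n$ is the subspace of $\mathbf{FQSym}$ spanned by all products $\pi_1\cdots\pi_s$ (product of $\mathbf{FQSym}$, $s\ge0$) where each $\pi_k$ is in the image of some $\mathrm{Lie}_{j_k}$. *)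

theory Defs
  imports Complex_Main "HOL-Library.Poly_Mapping" "HOL-Combinatorics.Multiset_Permutations"
begin

section \<open>Free vector spaces\<close>

text \<open>
  The type \<^typ>\<open>'b \<Rightarrow>\<^sub>0 'k\<close> of finitely supported functions is the vector space over \<open>'k\<close> with
  basis \<open>'b\<close>; the basis vector of \<open>x\<close> is \<^term>\<open>Poly_Mapping.single x 1\<close>.
\<close>

definition scale :: "'k::field \<Rightarrow> ('b \<Rightarrow>\<^sub>0 'k) \<Rightarrow> ('b \<Rightarrow>\<^sub>0 'k)" where
  "scale c f = Poly_Mapping.map ((*) c) f"

lemma lookup_scale [simp]: "Poly_Mapping.lookup (scale c f) x = c * Poly_Mapping.lookup f x"
  by (simp add: scale_def Poly_Mapping.map.rep_eq when_def)

interpretation fsv: vector_space "scale :: 'k::field \<Rightarrow> ('b \<Rightarrow>\<^sub>0 'k) \<Rightarrow> ('b \<Rightarrow>\<^sub>0 'k)"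
  by unfold_locales (auto intro!: poly_mapping_eqI simp: lookup_add algebra_simps)

definition linear_ext :: "('b \<Rightarrow> ('c \<Rightarrow>\<^sub>0 'k::field)) \<Rightarrow> ('b \<Rightarrow>\<^sub>0 'k) \<Rightarrow> ('c \<Rightarrow>\<^sub>0 'k)" where
  "linear_ext \<phi> f = (\<Sum>x\<in>Poly_Mapping.keys f. scale (Poly_Mapping.lookup f x) (\<phi> x))"

definition bilinear_ext ::
  "('a \<Rightarrow> 'b \<Rightarrow> ('c \<Rightarrow>\<^sub>0 'k::field)) \<Rightarrow> ('a \<Rightarrow>\<^sub>0 'k) \<Rightarrow> ('b \<Rightarrow>\<^sub>0 'k) \<Rightarrow> ('c \<Rightarrow>\<^sub>0 'k)" where
  "bilinear_ext \<phi> f g = linear_ext (\<lambda>x. linear_ext (\<lambda>y. \<phi> x y) g) f"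


section \<open>Permutations as words and standardization\<close>

text \<open>
  A permutation \<open>\<sigma>\<close> of \<open>{1..n}\<close> is the word \<open>[\<sigma> 1, \<dots>, \<sigma> n]\<close>. List positions count from 0,
  so \<open>\<sigma> i\<close> is \<open>\<sigma> ! (i - 1)\<close>.
\<close>

definition perm_words :: "nat list set" where
  "perm_words = (\<Union>n. permutations_of_set {1..n})"

text \<open>\<open>perm_comp \<tau> \<sigma>\<close> is \<open>\<tau>\<sigma>\<close>, that is \<open>i \<mapsto> \<tau> (\<sigma> i)\<close>.\<close>

definition perm_comp :: "nat list \<Rightarrow> nat list \<Rightarrow> nat list" where
  "perm_comp \<tau> \<sigma> = map (\<lambda>i. \<tau> ! (i - 1)) \<sigma>"

definition perm_inv :: "nat list \<Rightarrow> nat list" where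
  "perm_inv \<sigma> = map (\<lambda>i. Suc (LEAST k. \<sigma> ! k = i)) [1..<Suc (length \<sigma>)]"

text \<open>
  Labelling the occurrences of the smallest letter from left to right, then those of the next
  letter, and so on, gives to position \<open>i\<close> as label the number of positions that are labelled
  no later than \<open>i\<close>: those with a smaller letter, and those up to \<open>i\<close> with the same letter.
\<close>

definition std :: "'a::linorder list \<Rightarrow> nat list" where
  "std w = map (\<lambda>i. card {j. j < length w \<and> (w ! j < w ! i \<or> w ! j = w ! i \<and> j \<le> i)})
             [0..<length w]"


section \<open>The algebra FQSym\<close>

text \<open>
  An element of FQSym is given by its coordinates in the basis \<open>G\<^sub>\<sigma>\<close>; thus FQSym is the set of
  those finitely supported functions on words whose support consists of permutations.
\<close>

definition FQSym :: "(nat list \<Rightarrow>\<^sub>0 'k::field) set" where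
  "FQSym = {f. Poly_Mapping.keys f \<subseteq> perm_words}"

definition bG :: "nat list \<Rightarrow> (nat list \<Rightarrow>\<^sub>0 'k::field)" where
  "bG \<sigma> = Poly_Mapping.single \<sigma> 1"

definition convolution :: "nat list \<Rightarrow> nat list \<Rightarrow> nat list set" where
  "convolution \<alpha> \<beta> = {\<gamma> \<in> perm_words. \<exists>u v. \<gamma> = u @ v \<and> std u = \<alpha> \<and> std v = \<beta>}"

definition fq_mult :: "(nat list \<Rightarrow>\<^sub>0 'k::field) \<Rightarrow> (nat list \<Rightarrow>\<^sub>0 'k) \<Rightarrow> (nat list \<Rightarrow>\<^sub>0 'k)" where
  "fq_mult = bilinear_ext (\<lambda>\<alpha> \<beta>. \<Sum>\<gamma>\<in>convolution \<alpha> \<beta>. bG \<gamma>)"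

text \<open>The product \<open>F\<^sub>1 \<cdots> F\<^sub>r\<close>; the unit is \<open>bG\<close> of the empty permutation.\<close>

definition fq_prod :: "(nat list \<Rightarrow>\<^sub>0 'k::field) list \<Rightarrow> (nat list \<Rightarrow>\<^sub>0 'k)" where
  "fq_prod Fs = foldr fq_mult Fs (bG [])"

definition fq_internal ::
  "(nat list \<Rightarrow>\<^sub>0 'k::field) \<Rightarrow> (nat list \<Rightarrow>\<^sub>0 'k) \<Rightarrow> (nat list \<Rightarrow>\<^sub>0 'k)" where
  "fq_internal = bilinear_ext
     (\<lambda>\<sigma> \<tau>. if length \<sigma> = length \<tau> then bG (perm_comp \<tau> \<sigma>) else 0)"


subsection \<open>Realization by noncommutative power series\<close>

text \<open>
  \<open>realize f\<close> is the noncommutative power series (as the function giving the coefficient of each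
  word) that \<open>f\<close> stands for: by \<open>realize_G\<close>, \<open>G\<^sub>\<sigma>\<close> stands for the sum of all words \<open>w\<close> with
  \<open>std w = \<sigma>\<close>. By \<open>realize_mult\<close>, \<^const>\<open>fq_mult\<close> is the product of such series.
\<close>

definition realize :: "(nat list \<Rightarrow>\<^sub>0 'k::field) \<Rightarrow> 'a::linorder list \<Rightarrow> 'k" where
  "realize f w = Poly_Mapping.lookup f (std w)"

lemma realize_G: "realize (bG \<sigma>) w = (if std w = \<sigma> then 1 else 0)"
  by (auto simp: realize_def bG_def lookup_single when_def)

lemma finite_perm_words_length: "finite {w \<in> perm_words. length w = n}"
proof -
  have "{w \<in> perm_words. length w = n} \<subseteq> permutations_of_set {1..n}"
    using length_finite_permutations_of_set by (fastforce simp: perm_words_def)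
  then show ?thesis
    by (rule finite_subset) simp
qed

lemma length_std [simp]: "length (std w) = length w"
  by (simp add: std_def)

lemma finite_convolution: "finite (convolution \<alpha> \<beta>)"
  by (rule finite_subset[OF _ finite_perm_words_length[of "length \<alpha> + length \<beta>"]])
     (auto simp: convolution_def)

lemma nth_std:
  "i < length w \<Longrightarrow>
   std w ! i = card {j. j < length w \<and> (w ! j < w ! i \<or> w ! j = w ! i \<and> j \<le> i)}"
  by (simp add: std_def)

lemma std_less_iff:
  assumes "i < length w" "j < length w"
  shows "std w ! i < std w ! j \<longleftrightarrow> w ! i < w ! j \<or> w ! i = w ! j \<and> i < j"
proof -
  have *: "std w ! k < std w ! l"
    if "k < length w" "l < length w" "w ! k < w ! l \<or> w ! k = w ! l \<and> k < l" for k l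
    unfolding nth_std[OF that(1)] nth_std[OF that(2)]
  proof (rule psubset_card_mono)
    show "{j. j < length w \<and> (w ! j < w ! k \<or> w ! j = w ! k \<and> j \<le> k)}
        \<subset> {j. j < length w \<and> (w ! j < w ! l \<or> w ! j = w ! l \<and> j \<le> l)}" (is "?A \<subset> ?B")
    proof
      show "?A \<subseteq> ?B" using that by auto
      have "l \<in> ?B" "l \<notin> ?A" using that by auto
      then show "?A \<noteq> ?B" by blast
    qed
  qed simp
  show ?thesis
    using *[OF assms] *[OF assms(2,1)] assms
    by (metis less_asym linorder_cases less_irrefl)
qed

lemma nth_eq_std_iff:
  assumes "i < length w" "j < length w"
  shows "std w ! i = std w ! j \<longleftrightarrow> i = j"
proof
  assume eq: "std w ! i = std w ! j"
  show "i = j"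
  proof (rule ccontr)
    assume "i \<noteq> j"
    then have "std w ! i < std w ! j \<or> std w ! j < std w ! i"
      unfolding std_less_iff[OF assms] std_less_iff[OF assms(2,1)] by auto
    with eq show False by simp
  qed
qed simp

lemma std_in_perm_words: "std w \<in> perm_words"
proof -
  have sub: "set (std w) \<subseteq> {1..length w}"
  proof
    fix x assume "x \<in> set (std w)"
    then obtain i where i: "i < length w" "x = std w ! i"
      by (metis in_set_conv_nth length_std)
    let ?A = "{j. j < length w \<and> (w ! j < w ! i \<or> w ! j = w ! i \<and> j \<le> i)}"
    have "i \<in> ?A" "?A \<subseteq> {..<length w}" "finite ?A" using i by auto
    then have "0 < card ?A" "card ?A \<le> length w"
      using card_mono[of "{..<length w}" ?A] by (auto simp only: card_gt_0_iff card_lessThan finite_lessThan)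
    then show "x \<in> {1..length w}" using i by (simp add: nth_std)
  qed
  have d: "distinct (std w)"
    by (simp add: distinct_conv_nth nth_eq_std_iff)
  then have "card (set (std w)) = length w" by (simp add: distinct_card)
  then have "set (std w) = {1..length w}" using sub by (simp add: card_subset_eq)
  with d show ?thesis by (auto simp: perm_words_def permutations_of_set_def)
qed

lemma std_cong:
  assumes "length u = length v"
    and "\<And>i j. i < length u \<Longrightarrow> j < length u \<Longrightarrow>
           (u ! i < u ! j \<or> u ! i = u ! j \<and> i < j) \<longleftrightarrow> (v ! i < v ! j \<or> v ! i = v ! j \<and> i < j)"
  shows "std u = std v"
proof (rule nth_equalityI)
  fix i assume "i < length (std u)"
  then have i: "i < length u" by simp
  have aux: "(w ! j < w ! i \<or> w ! j = w ! i \<and> j \<le> i) \<longleftrightarrow>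
        j = i \<or> (w ! j < w ! i \<or> w ! j = w ! i \<and> j < i)" for j and w :: "'z::linorder list"
    by (auto simp: le_less)
  have "{j. j < length u \<and> (u ! j < u ! i \<or> u ! j = u ! i \<and> j \<le> i)} =
        {j. j < length v \<and> (v ! j < v ! i \<or> v ! j = v ! i \<and> j \<le> i)}"
  proof (rule Collect_cong)
    fix j
    show "j < length u \<and> (u ! j < u ! i \<or> u ! j = u ! i \<and> j \<le> i) \<longleftrightarrow>
          j < length v \<and> (v ! j < v ! i \<or> v ! j = v ! i \<and> j \<le> i)"
      unfolding aux using assms(1) assms(2)[of j i] i by metis
  qed
  then show "std u ! i = std v ! i" using assms(1) i by (simp add: nth_std)
qed (use assms in simp)

lemma std_take_std: "std (take k (std w)) = std (take k w)"
  by (rule std_cong) (auto simp: std_less_iff nth_eq_std_iff)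

lemma std_drop_std: "std (drop k (std w)) = std (drop k w)"
  by (rule std_cong) (auto simp: std_less_iff nth_eq_std_iff)

lemma std_in_convolution_iff:
  "std w \<in> convolution \<alpha> \<beta> \<longleftrightarrow>
   length \<alpha> \<le> length w \<and> std (take (length \<alpha>) w) = \<alpha> \<and> std (drop (length \<alpha>) w) = \<beta>"
proof
  assume "std w \<in> convolution \<alpha> \<beta>"
  then obtain u v where *: "std w = u @ v" "std u = \<alpha>" "std v = \<beta>"
    by (auto simp: convolution_def)
  then have l: "length u = length \<alpha>" "length (std w) = length u + length v"
    by (metis length_std, metis length_append)
  have "u = take (length \<alpha>) (std w)" "v = drop (length \<alpha>) (std w)"
    unfolding *(1) l(1)[symmetric] by simp_all
  then show "length \<alpha> \<le> length w \<and> std (take (length \<alpha>) w) = \<alpha> \<and> std (drop (length \<alpha>) w) = \<beta>"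
    using *(2,3) l std_take_std[of "length \<alpha>" w] std_drop_std[of "length \<alpha>" w] by (metis le_add1 length_std)
next
  assume "length \<alpha> \<le> length w \<and> std (take (length \<alpha>) w) = \<alpha> \<and> std (drop (length \<alpha>) w) = \<beta>"
  then have "std w = take (length \<alpha>) (std w) @ drop (length \<alpha>) (std w)"
    "std (take (length \<alpha>) (std w)) = \<alpha>" "std (drop (length \<alpha>) (std w)) = \<beta>"
    by (simp_all only: std_take_std std_drop_std append_take_drop_id)
  then show "std w \<in> convolution \<alpha> \<beta>"
    unfolding convolution_def using std_in_perm_words[of w] by blast
qed

lemma realize_mult:
  fixes f g :: "nat list \<Rightarrow>\<^sub>0 'k::field"
  shows "realize (fq_mult f g) w =
     (\<Sum>k\<le>length w. realize f (take k w) * realize g (drop k w))"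
proof -
  let ?l = Poly_Mapping.lookup
  let ?P = "\<lambda>\<alpha>. length \<alpha> \<le> length w \<and> std (take (length \<alpha>) w) = \<alpha>"
  have sumG: "?l (\<Sum>\<gamma>\<in>convolution \<alpha> \<beta>. bG \<gamma>) (std w) = (if std w \<in> convolution \<alpha> \<beta> then 1 else (0 :: 'k))"
    for \<alpha> \<beta>
    by (simp add: lookup_sum bG_def lookup_single when_def finite_convolution sum.delta)
  have "realize (fq_mult f g) w =
    (\<Sum>\<alpha>\<in>Poly_Mapping.keys f. ?l f \<alpha> * (\<Sum>\<beta>\<in>Poly_Mapping.keys g. ?l g \<beta> *
        (if std w \<in> convolution \<alpha> \<beta> then 1 else 0)))"
    by (simp add: realize_def fq_mult_def bilinear_ext_def linear_ext_def lookup_sum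
        sumG[unfolded lookup_sum])
  also have "\<dots> = (\<Sum>\<alpha>\<in>Poly_Mapping.keys f. if ?P \<alpha> then ?l f \<alpha> * realize g (drop (length \<alpha>) w) else 0)"
    (is "_ = ?S")
  proof (rule sum.cong[OF refl])
    fix \<alpha>
    have "(\<Sum>\<beta>\<in>Poly_Mapping.keys g. ?l g \<beta> * (if std w \<in> convolution \<alpha> \<beta> then 1 else 0)) =
      (\<Sum>\<beta>\<in>Poly_Mapping.keys g. if std (drop (length \<alpha>) w) = \<beta> then (if ?P \<alpha> then ?l g \<beta> else 0) else 0)"
      by (rule sum.cong) (auto simp: std_in_convolution_iff)
    also have "\<dots> = (if ?P \<alpha> then realize g (drop (length \<alpha>) w) else 0)"
      by (auto simp: realize_def in_keys_iff)
    finally show "?l f \<alpha> * (\<Sum>\<beta>\<in>Poly_Mapping.keys g. ?l g \<beta> * (if std w \<in> convolution \<alpha> \<beta> then 1 else 0))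
      = (if ?P \<alpha> then ?l f \<alpha> * realize g (drop (length \<alpha>) w) else 0)" by simp
  qed
  also have "?S = (\<Sum>\<alpha>\<in>Poly_Mapping.keys f. \<Sum>k\<le>length w.
      if std (take k w) = \<alpha> then ?l f \<alpha> * realize g (drop k w) else 0)"
  proof (rule sum.cong[OF refl])
    fix \<alpha>
    have "(\<Sum>k\<le>length w. if std (take k w) = \<alpha> then ?l f \<alpha> * realize g (drop k w) else 0) =
      (\<Sum>k\<le>length w. if length \<alpha> = k then (if ?P \<alpha> then ?l f \<alpha> * realize g (drop k w) else 0) else 0)"
      by (rule sum.cong) auto
    also have "\<dots> = (if ?P \<alpha> then ?l f \<alpha> * realize g (drop (length \<alpha>) w) else 0)"
      by simp
    finally show "(if ?P \<alpha> then ?l f \<alpha> * realize g (drop (length \<alpha>) w) else 0) =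
      (\<Sum>k\<le>length w. if std (take k w) = \<alpha> then ?l f \<alpha> * realize g (drop k w) else 0)" by simp
  qed
  also have "\<dots> = (\<Sum>k\<le>length w. \<Sum>\<alpha>\<in>Poly_Mapping.keys f.
      if std (take k w) = \<alpha> then ?l f \<alpha> * realize g (drop k w) else 0)"
    by (rule sum.swap)
  also have "\<dots> = (\<Sum>k\<le>length w. realize f (take k w) * realize g (drop k w))"
    by (rule sum.cong) (auto simp: realize_def in_keys_iff)
  finally show ?thesis .
qed


section \<open>Tensor powers and the coproduct\<close>

text \<open>
  The tensor power \<open>FQSym\<^sup>\<otimes>\<^sup>r\<close> has the basis \<open>G\<^sub>\<sigma>\<^sub>1 \<otimes> \<cdots> \<otimes> G\<^sub>\<sigma>\<^sub>r\<close>, indexed by the lists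
  \<open>[\<sigma>\<^sub>1, \<dots>, \<sigma>\<^sub>r]\<close> of permutations; its elements are finitely supported functions on such lists.
  \<open>tensor\<close> is the concatenation of tensors, from the \<open>r\<close>-th and \<open>s\<close>-th to the \<open>(r+s)\<close>-th power.
\<close>

definition tensor1 :: "(nat list \<Rightarrow>\<^sub>0 'k::field) \<Rightarrow> (nat list list \<Rightarrow>\<^sub>0 'k)" where
  "tensor1 = linear_ext (\<lambda>\<sigma>. Poly_Mapping.single [\<sigma>] 1)"

definition tensor ::
  "(nat list list \<Rightarrow>\<^sub>0 'k::field) \<Rightarrow> (nat list list \<Rightarrow>\<^sub>0 'k) \<Rightarrow> (nat list list \<Rightarrow>\<^sub>0 'k)" where
  "tensor = bilinear_ext (\<lambda>\<sigma>s \<tau>s. Poly_Mapping.single (\<sigma>s @ \<tau>s) 1)"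

definition pure_tensor :: "(nat list \<Rightarrow>\<^sub>0 'k::field) list \<Rightarrow> (nat list list \<Rightarrow>\<^sub>0 'k)" where
  "pure_tensor Fs = foldr (\<lambda>F. tensor (tensor1 F)) Fs (Poly_Mapping.single [] 1)"

definition mu :: "(nat list list \<Rightarrow>\<^sub>0 'k::field) \<Rightarrow> (nat list \<Rightarrow>\<^sub>0 'k)" where
  "mu = linear_ext (\<lambda>\<sigma>s. fq_prod (map bG \<sigma>s))"

definition tensor_internal ::
  "(nat list list \<Rightarrow>\<^sub>0 'k::field) \<Rightarrow> (nat list list \<Rightarrow>\<^sub>0 'k) \<Rightarrow> (nat list list \<Rightarrow>\<^sub>0 'k)" where
  "tensor_internal = bilinear_ext (\<lambda>\<sigma>s \<tau>s.
     if length \<sigma>s = length \<tau>s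
     then pure_tensor (map2 (\<lambda>\<sigma> \<tau>. fq_internal (bG \<sigma>) (bG \<tau>)) \<sigma>s \<tau>s) else 0)"

definition bF :: "nat list \<Rightarrow> (nat list \<Rightarrow>\<^sub>0 'k::field)" where
  "bF \<sigma> = bG (perm_inv \<sigma>)"

text \<open>
  The coproduct is prescribed on the basis \<open>bF\<close>; it is written here on the basis
  \<open>bG \<sigma> = bF (perm_inv \<sigma>)\<close>.
\<close>

definition coprod :: "(nat list \<Rightarrow>\<^sub>0 'k::field) \<Rightarrow> (nat list list \<Rightarrow>\<^sub>0 'k)" where
  "coprod = linear_ext (\<lambda>\<sigma>. \<Sum>(u, v)\<in>{(u, v). u @ v = perm_inv \<sigma>}. pure_tensor [bF (std u), bF (std v)])"

lemma finite_factorizations: "finite {(u, v). u @ v = w}"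
proof -
  have "{(u, v). u @ v = w} \<subseteq> (\<lambda>k. (take k w, drop k w)) ` {..length w}"
  proof
    fix x assume "x \<in> {(u, v). u @ v = w}"
    then obtain u v where x: "x = (u, v)" "w = u @ v" by auto
    show "x \<in> (\<lambda>k. (take k w, drop k w)) ` {..length w}"
      by (rule image_eqI[of _ _ "length u"]) (simp_all add: x)
  qed
  then show ?thesis
    by (rule finite_subset) simp
qed

text \<open>\<open>\<Delta> \<otimes> id \<otimes> \<cdots> \<otimes> id\<close>.\<close>

definition coprod_first :: "(nat list list \<Rightarrow>\<^sub>0 'k::field) \<Rightarrow> (nat list list \<Rightarrow>\<^sub>0 'k)" where
  "coprod_first = linear_ext (\<lambda>\<sigma>s. tensor (coprod (bG (hd \<sigma>s))) (pure_tensor (map bG (tl \<sigma>s))))"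

text \<open>
  \<open>coprod_iter r\<close> is \<open>\<Delta>\<^sup>r : FQSym \<rightarrow> FQSym\<^sup>\<otimes>\<^sup>r\<close> for \<open>r \<ge> 1\<close>: the coproduct is applied
  \<open>r - 1\<close> times, so that \<open>\<Delta>\<^sup>1\<close> is the identity and \<open>\<Delta>\<^sup>2 = \<Delta>\<close>.
\<close>

definition coprod_iter :: "nat \<Rightarrow> (nat list \<Rightarrow>\<^sub>0 'k::field) \<Rightarrow> (nat list list \<Rightarrow>\<^sub>0 'k)" where
  "coprod_iter r H = (coprod_first ^^ (r - 1)) (tensor1 H)"


section \<open>The Patras--Reutenauer algebra\<close>

definition concat_mult :: "(nat list \<Rightarrow>\<^sub>0 'k::field) \<Rightarrow> (nat list \<Rightarrow>\<^sub>0 'k) \<Rightarrow> (nat list \<Rightarrow>\<^sub>0 'k)" where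
  "concat_mult = bilinear_ext (\<lambda>u v. Poly_Mapping.single (u @ v) 1)"

text \<open>
  The free Lie algebra on the letters \<open>1, \<dots>, j\<close>, as the Lie subalgebra generated by the letters
  in the free associative algebra.
\<close>

definition free_lie :: "nat \<Rightarrow> (nat list \<Rightarrow>\<^sub>0 'k::field) set" where
  "free_lie j = \<Inter>{L. fsv.subspace L \<and>
     (\<forall>i\<in>{1..j}. Poly_Mapping.single [i] 1 \<in> L) \<and>
     (\<forall>p\<in>L. \<forall>q\<in>L. concat_mult p q - concat_mult q p \<in> L)}"

definition Lie :: "nat \<Rightarrow> (nat list \<Rightarrow>\<^sub>0 'k::field) set" where
  "Lie j = {p \<in> free_lie j. Poly_Mapping.keys p \<subseteq> permutations_of_set {1..j}}"

definition PR_algebra :: "(nat list \<Rightarrow>\<^sub>0 'k::field) set" where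
  "PR_algebra = fsv.span {fq_prod (map (linear_ext bG) ps) | ps. \<forall>p\<in>set ps. \<exists>j\<ge>1. p \<in> Lie j}"

end

theory Submission
  imports Defs
begin

text \<open>
  An element \<open>H\<close> of degree \<open>n\<close> acts on words of length \<open>n\<close>: inserting the letters of \<open>w\<close> gives the
  element \<open>\<Sum>\<^sub>\<tau> H(\<tau>) w\<tau>\<close> of the free associative algebra, where \<open>w\<tau>\<close> is \<open>perm_comp w \<tau>\<close>. The point
  of the proof is that an element of the Patras--Reutenauer algebra acts compatibly with partial
  commutation (\<open>PR_algebra_respects_traces\<close>): colour the letters and let neighbouring letters of
  different colours commute; if \<open>u\<close> and \<open>v\<close> are equal modulo this commutation, then so are the
  results of inserting \<open>u\<close> and \<open>v\<close> into \<open>H\<close>.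

  For a Lie element this holds because inserting a word with two colours gives zero modulo
  commutation: the letters of different colours then generate commuting Lie algebras, and a Lie
  polynomial in which both kinds of letters occur vanishes. Formally, Lie polynomials are primitive
  for the unshuffling coproduct (\<open>free_lie_primitive\<close>), so their mixed components are zero
  (\<open>respects_traces_Lie\<close>). For a product, inserting \<open>w\<close> into \<open>\<pi>\<^sub>1 \<pi>\<^sub>2\<close> amounts to summing over all
  ways to split \<open>w\<close> into two complementary subwords \<open>u\<close> and \<open>v\<close> and to multiplying the results of
  inserting \<open>u\<close> into \<open>\<pi>\<^sub>1\<close> and \<open>v\<close> into \<open>\<pi>\<^sub>2\<close> (\<open>substitute_fq_mult\<close>). Exchanging two neighbouring
  letters of \<open>w\<close> exchanges them in \<open>u\<close>, or in \<open>v\<close>, or in neither, so compatibility is inherited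
  (\<open>respects_traces_fq_mult\<close>).

  The splitting formula is an instance of this compatibility. By multilinearity each \<open>F\<^sub>i\<close> may be
  taken to be a basis element \<open>G\<^sub>\<sigma>\<^sub>i\<close>. Compare the coefficients of a permutation \<open>\<gamma>\<close>, and cut \<open>\<gamma>\<close> into
  consecutive blocks \<open>b\<^sub>1, \<dots>, b\<^sub>r\<close> of the lengths of the \<open>\<sigma>\<^sub>i\<close>. A term \<open>\<tau>\<close> of \<open>H\<close> contributes to the
  left side iff, for each \<open>i\<close>, the positions in \<open>\<tau>\<close> of the letters of \<open>b\<^sub>i\<close> standardize to \<open>\<sigma>\<^sub>i\<close>. It
  contributes to the right side iff the same is true with \<open>\<tau>\<close> replaced by \<open>w\<tau>\<close>, where \<open>w\<close> is the
  concatenation of the blocks, each sorted increasingly: the iterated coproduct restricts \<open>\<tau>\<close> to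
  consecutive intervals of letters, and \<open>w\<close> maps these intervals increasingly onto the blocks. The
  condition sees only the relative order of letters of the same block, and \<open>1 2 \<dots> n\<close> is turned into
  \<open>w\<close> by commuting letters of different blocks; so both sides agree (\<open>respects_traces_blocks\<close>).
\<close>


section \<open>Pairing with test functions\<close>

text \<open>
  Two elements of a free vector space are equal iff they have the same pairing with every function
  on the basis, or just with the coordinate functions (\<open>lookup_eq_pairing\<close>). Under the pairing,
  linear and bilinear extensions become iterated pairings, which can be exchanged freely
  (\<open>pairing_swap\<close>); this keeps sums over supports out of the later arguments.
\<close>

definition pairing :: "('b \<Rightarrow>\<^sub>0 'k::field) \<Rightarrow> ('b \<Rightarrow> 'k) \<Rightarrow> 'k" where
  "pairing f \<phi> = (\<Sum>x\<in>Poly_Mapping.keys f. Poly_Mapping.lookup f x * \<phi> x)"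

lemma pairing_superset:
  assumes "finite A" "Poly_Mapping.keys f \<subseteq> A"
  shows "pairing f \<phi> = (\<Sum>x\<in>A. Poly_Mapping.lookup f x * \<phi> x)"
  unfolding pairing_def
  by (rule sum.mono_neutral_left) (use assms in \<open>auto simp: in_keys_iff\<close>)

lemma pairing_cong:
  "(\<And>x. x \<in> Poly_Mapping.keys f \<Longrightarrow> \<phi> x = \<psi> x) \<Longrightarrow> pairing f \<phi> = pairing f \<psi>"
  by (simp add: pairing_def)

lemma pairing_single [simp]: "pairing (Poly_Mapping.single x 1) \<phi> = \<phi> x"
  by (simp add: pairing_def)

lemma pairing_bG [simp]: "pairing (bG x) \<phi> = \<phi> x"
  by (simp add: bG_def)

lemma pairing_0 [simp]: "pairing 0 \<phi> = 0"
  by (simp add: pairing_def)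

lemma pairing_zero_fun [simp]: "pairing f (\<lambda>x. 0) = 0"
  by (simp add: pairing_def)

lemma pairing_add: "pairing (f + g) \<phi> = pairing f \<phi> + pairing g \<phi>"
proof -
  let ?A = "Poly_Mapping.keys f \<union> Poly_Mapping.keys g"
  have "Poly_Mapping.keys (f + g) \<subseteq> ?A" by (rule keys_add)
  then show ?thesis
    by (simp add: pairing_superset[of ?A] lookup_add algebra_simps sum.distrib)
qed

lemma pairing_scale: "pairing (scale a f) \<phi> = a * pairing f \<phi>"
proof -
  have "Poly_Mapping.keys (scale a f) \<subseteq> Poly_Mapping.keys f"
    by (auto simp: in_keys_iff)
  then show ?thesis
    by (simp add: pairing_superset[of "Poly_Mapping.keys f"] sum_distrib_left algebra_simps)
qed

lemma pairing_diff: "pairing (f - g) \<phi> = pairing f \<phi> - pairing g \<phi>"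
  using pairing_add[of "f - g" g \<phi>] by simp

lemma pairing_sum: "pairing (\<Sum>i\<in>I. f i) \<phi> = (\<Sum>i\<in>I. pairing (f i) \<phi>)"
  by (induction I rule: infinite_finite_induct) (simp_all add: pairing_add)

lemma pairing_fun_add: "pairing f (\<lambda>x. \<phi> x + \<psi> x) = pairing f \<phi> + pairing f \<psi>"
  by (simp add: pairing_def algebra_simps sum.distrib)

lemma pairing_fun_scale: "pairing f (\<lambda>x. a * \<phi> x) = a * pairing f \<phi>"
  by (simp add: pairing_def sum_distrib_left algebra_simps)

lemma pairing_fun_sum: "pairing f (\<lambda>x. \<Sum>i\<in>I. \<phi> i x) = (\<Sum>i\<in>I. pairing f (\<phi> i))"
  by (induction I rule: infinite_finite_induct) (simp_all add: pairing_fun_add)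

lemma pairing_swap: "pairing f (\<lambda>x. pairing g (\<lambda>y. \<phi> x y)) = pairing g (\<lambda>y. pairing f (\<lambda>x. \<phi> x y))"
  unfolding pairing_def sum_distrib_left
  by (subst sum.swap) (simp add: algebra_simps)

lemma pairing_linear_ext: "pairing (linear_ext \<phi> f) \<psi> = pairing f (\<lambda>x. pairing (\<phi> x) \<psi>)"
  by (simp add: linear_ext_def pairing_sum pairing_scale) (simp add: pairing_def)

lemma pairing_bilinear_ext:
  "pairing (bilinear_ext \<phi> f g) \<psi> = pairing f (\<lambda>x. pairing g (\<lambda>y. pairing (\<phi> x y) \<psi>))"
  by (simp add: bilinear_ext_def pairing_linear_ext)

lemma lookup_eq_pairing: "Poly_Mapping.lookup f y = pairing f (\<lambda>x. if x = y then 1 else 0)"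
proof -
  have "pairing f (\<lambda>x. if x = y then 1 else 0) =
      (\<Sum>x\<in>Poly_Mapping.keys f. if x = y then Poly_Mapping.lookup f x else 0)"
    unfolding pairing_def by (rule sum.cong) auto
  then show ?thesis by (simp add: in_keys_iff)
qed

lemma pairing_if: "pairing f (\<lambda>x. if P then \<phi> x else 0) = (if P then pairing f \<phi> else 0)"
  by simp

lemma linear_ext_bG: "linear_ext bG p = p"
  by (rule poly_mapping_eqI) (simp add: lookup_eq_pairing pairing_linear_ext)

lemma pairing_fq_mult:
  "pairing (fq_mult f g) \<psi> = pairing f (\<lambda>\<alpha>. pairing g (\<lambda>\<beta>. \<Sum>\<gamma>\<in>convolution \<alpha> \<beta>. \<psi> \<gamma>))"
  by (simp add: fq_mult_def pairing_bilinear_ext pairing_sum)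

lemma pairing_concat_mult:
  "pairing (concat_mult f g) \<psi> = pairing f (\<lambda>u. pairing g (\<lambda>v. \<psi> (u @ v)))"
  by (simp add: concat_mult_def pairing_bilinear_ext)

lemma pairing_fq_internal:
  "pairing (fq_internal f g) \<psi> =
     pairing f (\<lambda>\<sigma>. pairing g (\<lambda>\<tau>. if length \<sigma> = length \<tau> then \<psi> (perm_comp \<tau> \<sigma>) else 0))"
  by (simp add: fq_internal_def pairing_bilinear_ext if_distrib[of "\<lambda>f. pairing f _"] cong: if_cong)

lemma pairing_tensor:
  "pairing (tensor X Y) \<psi> = pairing X (\<lambda>s. pairing Y (\<lambda>t. \<psi> (s @ t)))"
  by (simp add: tensor_def pairing_bilinear_ext)

lemma pairing_tensor1: "pairing (tensor1 F) \<psi> = pairing F (\<lambda>\<sigma>. \<psi> [\<sigma>])"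
  by (simp add: tensor1_def pairing_linear_ext)

lemma pairing_pure_tensor_Nil [simp]: "pairing (pure_tensor []) \<psi> = \<psi> []"
  by (simp add: pure_tensor_def)

lemma pairing_pure_tensor_Cons [simp]:
  "pairing (pure_tensor (F # Fs)) \<psi> =
     pairing F (\<lambda>\<sigma>. pairing (pure_tensor Fs) (\<lambda>\<sigma>s. \<psi> (\<sigma> # \<sigma>s)))"
  by (simp add: pure_tensor_def pairing_tensor pairing_tensor1)

lemma pairing_pure_tensor_bG [simp]: "pairing (pure_tensor (map bG \<sigma>s)) \<psi> = \<psi> \<sigma>s"
  by (induction \<sigma>s arbitrary: \<psi>) simp_all

lemma pairing_mu: "pairing (mu X) \<psi> = pairing X (\<lambda>\<sigma>s. pairing (fq_prod (map bG \<sigma>s)) \<psi>)"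
  by (simp add: mu_def pairing_linear_ext)

lemma fq_prod_Cons: "fq_prod (F # Fs) = fq_mult F (fq_prod Fs)"
  by (simp add: fq_prod_def)

text \<open>
  The product \<open>F\<^sub>1 \<cdots> F\<^sub>r\<close> is the image under \<^const>\<open>mu\<close> of the pure tensor of the \<open>F\<^sub>i\<close>, so both sides of
  the splitting formula are linear in this tensor.
\<close>

lemma pairing_fq_prod:
  "pairing (fq_prod Fs) \<psi> = pairing (pure_tensor Fs) (\<lambda>\<sigma>s. pairing (fq_prod (map bG \<sigma>s)) \<psi>)"
  by (induction Fs arbitrary: \<psi>) (simp_all add: fq_prod_Cons pairing_fq_mult)

lemma pairing_tensor_internal:
  "pairing (tensor_internal X Y) \<psi> = pairing X (\<lambda>\<sigma>s. pairing Y (\<lambda>\<tau>s.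
     if map length \<tau>s = map length \<sigma>s then \<psi> (map2 (\<lambda>\<sigma> \<tau>. perm_comp \<tau> \<sigma>) \<sigma>s \<tau>s) else 0))"
proof -
  have *: "pairing (pure_tensor (map2 (\<lambda>\<sigma> \<tau>. fq_internal (bG \<sigma>) (bG \<tau>)) \<sigma>s \<tau>s)) \<psi> =
    (if map length \<tau>s = map length \<sigma>s then \<psi> (map2 (\<lambda>\<sigma> \<tau>. perm_comp \<tau> \<sigma>) \<sigma>s \<tau>s) else 0)"
    if "length \<sigma>s = length \<tau>s" for \<sigma>s \<tau>s and \<psi> :: "nat list list \<Rightarrow> 'a"
    using that
    by (induction \<sigma>s \<tau>s arbitrary: \<psi> rule: list_induct2) (auto simp: pairing_fq_internal)
  have **: "map length \<tau>s \<noteq> map length \<sigma>s"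
    if "length \<sigma>s \<noteq> length \<tau>s" for \<sigma>s \<tau>s :: "nat list list"
    using that by (metis length_map)
  show ?thesis
    unfolding tensor_internal_def pairing_bilinear_ext
    by (intro pairing_cong) (auto simp: * dest: **)
qed


section \<open>Standardization and permutations\<close>

lemma perm_words_iff: "\<sigma> \<in> perm_words \<longleftrightarrow> distinct \<sigma> \<and> set \<sigma> = {1..length \<sigma>}"
proof
  assume "\<sigma> \<in> perm_words"
  then obtain n where n: "distinct \<sigma>" "set \<sigma> = {1..n}"
    by (auto simp: perm_words_def permutations_of_set_def)
  have "n = length \<sigma>" using distinct_card[OF n(1)] n(2) by simp
  with n show "distinct \<sigma> \<and> set \<sigma> = {1..length \<sigma>}" by blast
qed (auto simp: perm_words_def permutations_of_set_def)

lemma perm_wordsI: "distinct \<sigma> \<Longrightarrow> set \<sigma> = {1..n} \<Longrightarrow> \<sigma> \<in> perm_words"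
  by (auto simp: perm_words_def permutations_of_set_def)

lemma length_perm_comp [simp]: "length (perm_comp \<tau> \<sigma>) = length \<sigma>"
  by (simp add: perm_comp_def)

lemma perm_comp_upt: "perm_comp w [1..<Suc (length w)] = w"
  by (rule nth_equalityI) (auto simp: perm_comp_def simp del: upt_Suc)

lemma upt_perm_comp: "set \<sigma> \<subseteq> {1..n} \<Longrightarrow> perm_comp [1..<Suc n] \<sigma> = \<sigma>"
  unfolding perm_comp_def by (rule map_idI) (auto simp del: upt_Suc)

lemma perm_comp_assoc:
  assumes "set \<sigma> \<subseteq> {1..length \<tau>}"
  shows "perm_comp w (perm_comp \<tau> \<sigma>) = perm_comp (perm_comp w \<tau>) \<sigma>"
  using assms by (auto simp: perm_comp_def subset_iff)

lemma mset_perm_comp: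
  assumes "\<sigma> \<in> perm_words" "length \<sigma> = length w"
  shows "mset (perm_comp w \<sigma>) = mset w"
proof -
  have "mset \<sigma> = mset [1..<Suc (length w)]"
  proof (rule set_eq_iff_mset_eq_distinct[THEN iffD1])
    show "distinct \<sigma>" using assms by (simp add: perm_words_iff)
    have "set \<sigma> = {1..length w}" using assms by (simp add: perm_words_iff)
    then show "set \<sigma> = set [1..<Suc (length w)]"
      by (simp only: set_upt atLeastLessThanSuc_atLeastAtMost)
  qed (rule distinct_upt)
  then have "mset (perm_comp w \<sigma>) = mset (perm_comp w [1..<Suc (length w)])"
    by (simp only: perm_comp_def mset_map)
  then show ?thesis by (simp only: perm_comp_upt)
qed

lemma distinct_perm_comp:
  "\<sigma> \<in> perm_words \<Longrightarrow> length \<sigma> = length w \<Longrightarrow> distinct w \<Longrightarrow> distinct (perm_comp w \<sigma>)"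
  by (metis mset_perm_comp mset_eq_imp_distinct_iff)

lemma set_perm_comp:
  "\<sigma> \<in> perm_words \<Longrightarrow> length \<sigma> = length w \<Longrightarrow> set (perm_comp w \<sigma>) = set w"
  by (metis mset_perm_comp mset_eq_setD)

lemma perm_comp_in_perm_words:
  "\<sigma> \<in> perm_words \<Longrightarrow> \<tau> \<in> perm_words \<Longrightarrow> length \<sigma> = length \<tau> \<Longrightarrow> perm_comp \<tau> \<sigma> \<in> perm_words"
  unfolding perm_words_iff[of "perm_comp \<tau> \<sigma>"]
  using distinct_perm_comp[of \<sigma> \<tau>] set_perm_comp[of \<sigma> \<tau>] perm_words_iff[of \<tau>] by simp

lemma std_perm [simp]:
  assumes "\<sigma> \<in> perm_words"
  shows "std \<sigma> = \<sigma>"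
proof (rule nth_equalityI)
  fix i assume "i < length (std \<sigma>)"
  then have i: "i < length \<sigma>" by simp
  have d: "distinct \<sigma>" "set \<sigma> = {1..length \<sigma>}" using assms by (auto simp: perm_words_iff)
  let ?A = "{j. j < length \<sigma> \<and> (\<sigma> ! j < \<sigma> ! i \<or> \<sigma> ! j = \<sigma> ! i \<and> j \<le> i)}"
  have A: "?A = {j. j < length \<sigma> \<and> \<sigma> ! j \<le> \<sigma> ! i}"
    using d i by (auto simp: nth_eq_iff_index_eq le_less)
  have "inj_on ((!) \<sigma>) ?A" using d by (auto simp: inj_on_def nth_eq_iff_index_eq)
  moreover have "(!) \<sigma> ` ?A = {1..\<sigma> ! i}"
  proof -
    have "\<sigma> ! i \<le> length \<sigma>" using d i by (metis atLeastAtMost_iff nth_mem)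
    then have "x \<in> (!) \<sigma> ` ?A" if "x \<in> {1..\<sigma> ! i}" for x
    proof -
      have "x \<in> set \<sigma>" using that \<open>\<sigma> ! i \<le> length \<sigma>\<close> d by auto
      then show ?thesis unfolding A using that by (auto simp: in_set_conv_nth)
    qed
    moreover have "(!) \<sigma> ` ?A \<subseteq> {1..\<sigma> ! i}"
      unfolding A using d by (auto dest: nth_mem)
    ultimately show ?thesis by blast
  qed
  ultimately have "card ?A = card {1..\<sigma> ! i}" by (simp only: card_image[symmetric])
  then have "card ?A = \<sigma> ! i" by simp
  then show "std \<sigma> ! i = \<sigma> ! i" using i by (simp add: nth_std)
qed simp

text \<open>
  Distinct letters are compared like their labels, so standardization commutes with rearranging
  the places of a word.
\<close>

lemma std_perm_comp:
  assumes "\<kappa> \<in> perm_words" "length \<kappa> = length e" "distinct e"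
  shows "std (perm_comp e \<kappa>) = perm_comp (std e) \<kappa>"
proof -
  have "std (perm_comp e \<kappa>) = std (perm_comp (std e) \<kappa>)"
  proof (rule std_cong)
    fix i j assume "i < length (perm_comp e \<kappa>)" "j < length (perm_comp e \<kappa>)"
    then have ij: "i < length \<kappa>" "j < length \<kappa>" by auto
    then have "\<kappa> ! i \<in> {1..length e}" "\<kappa> ! j \<in> {1..length e}"
      using assms unfolding perm_words_iff by (metis nth_mem)+
    then have "\<kappa> ! i - 1 < length e" "\<kappa> ! j - 1 < length e" by auto
    with ij assms(3) show "(perm_comp e \<kappa> ! i < perm_comp e \<kappa> ! j \<or> perm_comp e \<kappa> ! i = perm_comp e \<kappa> ! j \<and> i < j) \<longleftrightarrow>
       (perm_comp (std e) \<kappa> ! i < perm_comp (std e) \<kappa> ! j \<or> perm_comp (std e) \<kappa> ! i = perm_comp (std e) \<kappa> ! j \<and> i < j)"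
      by (auto simp: perm_comp_def std_less_iff nth_eq_std_iff nth_eq_iff_index_eq)
  qed simp
  also have "\<dots> = perm_comp (std e) \<kappa>"
    using assms by (intro std_perm perm_comp_in_perm_words) (auto simp: std_in_perm_words)
  finally show ?thesis .
qed

lemma std_sorted:
  fixes s :: "nat list"
  assumes "sorted s"
  shows "std s = [1..<Suc (length s)]"
proof -
  have "std s = std [1..<Suc (length s)]"
  proof (rule std_cong)
    fix i j assume "i < length s" "j < length s"
    moreover from this have "i < j \<Longrightarrow> s ! i \<le> s ! j" "j < i \<Longrightarrow> s ! j \<le> s ! i"
      using assms by (auto simp: sorted_iff_nth_mono)
    ultimately show "(s ! i < s ! j \<or> s ! i = s ! j \<and> i < j) \<longleftrightarrow>
       ([1..<Suc (length s)] ! i < [1..<Suc (length s)] ! j \<or>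
        [1..<Suc (length s)] ! i = [1..<Suc (length s)] ! j \<and> i < j)"
      by (cases i j rule: linorder_cases) (auto simp del: upt_Suc)
  qed (simp del: upt_Suc)
  also have "\<dots> = [1..<Suc (length s)]"
    by (rule std_perm) (auto simp: perm_words_iff simp del: upt_Suc)
  finally show ?thesis .
qed

lemma std_perm_comp_sorted:
  fixes s :: "nat list"
  assumes "\<alpha> \<in> perm_words" "length \<alpha> = length s" "distinct s" "sorted s"
  shows "std (perm_comp s \<alpha>) = \<alpha>"
proof -
  have "set \<alpha> \<subseteq> {1..length s}" using assms(1,2) by (simp add: perm_words_iff)
  then show ?thesis
    by (simp only: std_perm_comp[OF assms(1-3)] std_sorted[OF assms(4)] upt_perm_comp)
qed

text \<open>
  A word with distinct letters is recovered from its set of letters and its order type.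
\<close>

lemma perm_comp_sort_std:
  fixes u :: "nat list"
  assumes "distinct u"
  shows "perm_comp (sort u) (std u) = u"
proof (rule nth_equalityI)
  fix i assume "i < length (perm_comp (sort u) (std u))"
  then have i: "i < length u" by simp
  \<comment> \<open>The label of \<open>u ! i\<close> is its rank in the set of letters, and so is its place in \<open>sort u\<close>.\<close>
  obtain k where k: "k < length u" "sort u ! k = u ! i"
    by (metis i in_set_conv_nth length_sort set_sort)
  have "std u ! i = card {j. j < length u \<and> u ! j \<le> u ! i}"
    unfolding nth_std[OF i]
    by (rule arg_cong[where f = card]) (use assms i in \<open>auto simp: nth_eq_iff_index_eq le_less\<close>)
  also have "\<dots> = length (filter (\<lambda>x. x \<le> u ! i) u)"
    by (simp add: length_filter_conv_card)
  also have "\<dots> = length (filter (\<lambda>x. x \<le> u ! i) (sort u))"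
    by (metis mset_filter mset_sort size_mset)
  also have "\<dots> = card {j. j < length u \<and> sort u ! j \<le> sort u ! k}"
    by (simp add: length_filter_conv_card k)
  also have "{j. j < length u \<and> sort u ! j \<le> sort u ! k} = {..k}"
  proof -
    have "sort u ! j \<le> sort u ! k \<longleftrightarrow> j \<le> k" if "j < length u" for j
    proof
      assume *: "sort u ! j \<le> sort u ! k"
      show "j \<le> k"
      proof (rule ccontr)
        assume "\<not> j \<le> k"
        then have "sort u ! k \<le> sort u ! j"
          using that by (intro sorted_nth_mono) auto
        with * have "sort u ! k = sort u ! j" by simp
        then show False
          using that k assms \<open>\<not> j \<le> k\<close> by (simp add: nth_eq_iff_index_eq)
      qed
    next
      assume "j \<le> k"
      then show "sort u ! j \<le> sort u ! k" by (rule sorted_nth_mono[OF sorted_sort]) (simp add: k)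
    qed
    then show ?thesis using k by auto
  qed
  finally have "std u ! i = Suc k" by simp
  then show "perm_comp (sort u) (std u) ! i = u ! i"
    using i k by (simp add: perm_comp_def)
qed simp

text \<open>
  A letter that does not occur gets the position after the last one. With this default, the effect
  of an exchange of neighbouring letters on positions can be described for arbitrary words.
\<close>

definition pos :: "'a list \<Rightarrow> 'a \<Rightarrow> nat" where
  "pos w x = length (takeWhile (\<lambda>y. y \<noteq> x) w)"

lemma pos_less: "x \<in> set w \<Longrightarrow> pos w x < length w"
  by (induction w) (auto simp: pos_def)

lemma nth_pos: "x \<in> set w \<Longrightarrow> w ! pos w x = x"
  by (induction w) (auto simp: pos_def)

lemma pos_nth: "distinct w \<Longrightarrow> i < length w \<Longrightarrow> pos w (w ! i) = i"
  by (metis nth_eq_iff_index_eq nth_mem nth_pos pos_less)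

lemma pos_map: "inj_on f (insert x (set w)) \<Longrightarrow> pos (map f w) (f x) = pos w x"
  by (induction w) (auto simp: pos_def inj_on_def)

lemma perm_inv_eq:
  assumes "\<sigma> \<in> perm_words"
  shows "perm_inv \<sigma> = map (\<lambda>x. Suc (pos \<sigma> x)) [1..<Suc (length \<sigma>)]"
proof -
  have "(LEAST k. \<sigma> ! k = x) = pos \<sigma> x" if "x \<in> set \<sigma>" for x
  proof (rule Least_equality)
    show "\<sigma> ! pos \<sigma> x = x" using that by (rule nth_pos)
    fix k assume k: "\<sigma> ! k = x"
    show "pos \<sigma> x \<le> k"
    proof (cases "k < length \<sigma>")
      case True
      then show ?thesis using pos_nth[of \<sigma> k] k assms by (simp add: perm_words_iff)
    next
      case False
      then show ?thesis using pos_less[OF that] by simp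
    qed
  qed
  then show ?thesis using assms by (auto simp: perm_inv_def perm_words_iff simp del: upt_Suc)
qed

lemma length_perm_inv [simp]: "length (perm_inv \<sigma>) = length \<sigma>"
  by (simp add: perm_inv_def del: upt_Suc)

lemma nth_perm_inv:
  assumes "\<sigma> \<in> perm_words" "x \<in> {1..length \<sigma>}"
  shows "perm_inv \<sigma> ! (x - 1) = Suc (pos \<sigma> x)"
proof -
  have "x - 1 < length [1..<Suc (length \<sigma>)]" "[1..<Suc (length \<sigma>)] ! (x - 1) = x"
    using assms(2) by (auto simp del: upt_Suc)
  then show ?thesis by (simp only: perm_inv_eq[OF assms(1)] nth_map)
qed

lemma perm_comp_perm_inv_left:
  assumes "\<sigma> \<in> perm_words" "set \<kappa> \<subseteq> {1..length \<sigma>}"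
  shows "perm_comp (perm_inv \<sigma>) (perm_comp \<sigma> \<kappa>) = \<kappa>"
proof -
  have "perm_inv \<sigma> ! (\<sigma> ! (x - 1) - 1) = x" if "x \<in> set \<kappa>" for x
  proof -
    have x: "1 \<le> x" "x - 1 < length \<sigma>" using that assms(2) by fastforce+
    then have "\<sigma> ! (x - 1) \<in> {1..length \<sigma>}" using assms(1) unfolding perm_words_iff by (metis nth_mem)
    then have "perm_inv \<sigma> ! (\<sigma> ! (x - 1) - 1) = Suc (pos \<sigma> (\<sigma> ! (x - 1)))"
      using assms(1) by (intro nth_perm_inv)
    then show ?thesis using x assms(1) by (simp add: pos_nth perm_words_iff)
  qed
  then show ?thesis by (auto simp: perm_comp_def intro!: map_idI)
qed

lemma perm_comp_perm_inv_right:
  assumes "\<sigma> \<in> perm_words" "set \<kappa> \<subseteq> {1..length \<sigma>}"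
  shows "perm_comp \<sigma> (perm_comp (perm_inv \<sigma>) \<kappa>) = \<kappa>"
proof -
  have "\<sigma> ! (perm_inv \<sigma> ! (x - 1) - 1) = x" if "x \<in> set \<kappa>" for x
  proof -
    have x: "x \<in> {1..length \<sigma>}" using that assms(2) by auto
    then have "perm_inv \<sigma> ! (x - 1) = Suc (pos \<sigma> x)"
      using assms(1) by (intro nth_perm_inv)
    then show ?thesis using x assms(1) by (simp add: nth_pos perm_words_iff)
  qed
  then show ?thesis by (auto simp: perm_comp_def intro!: map_idI)
qed

lemma perm_inv_in_perm_words:
  assumes "\<sigma> \<in> perm_words"
  shows "perm_inv \<sigma> \<in> perm_words"
proof -
  have d: "distinct \<sigma>" "set \<sigma> = {1..length \<sigma>}" using assms by (auto simp: perm_words_iff)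
  have "inj_on (\<lambda>x. Suc (pos \<sigma> x)) {1..length \<sigma>}"
    unfolding d(2)[symmetric] by (rule inj_onI) (metis Suc_inject nth_pos)
  then have di: "distinct (perm_inv \<sigma>)"
    using assms
    by (simp add: perm_inv_eq distinct_map atLeastLessThanSuc_atLeastAtMost del: upt_Suc)
  have "set (perm_inv \<sigma>) \<subseteq> {1..length \<sigma>}"
    using assms pos_less[of _ \<sigma>] d(2) by (fastforce simp: perm_inv_eq simp del: upt_Suc)
  then have "set (perm_inv \<sigma>) = {1..length \<sigma>}"
    using distinct_card[OF di] by (intro card_subset_eq) auto
  with di show ?thesis by (rule perm_wordsI)
qed

lemma perm_inv_perm_inv:
  assumes "\<sigma> \<in> perm_words"
  shows "perm_inv (perm_inv \<sigma>) = \<sigma>"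
proof -
  let ?\<rho> = "perm_inv \<sigma>"
  have \<rho>: "?\<rho> \<in> perm_words" using assms by (rule perm_inv_in_perm_words)
  have id: "perm_comp ?\<rho> \<sigma> = [1..<Suc (length \<sigma>)]"
    using perm_comp_perm_inv_left[OF assms, of "[1..<Suc (length \<sigma>)]"]
    by (simp add: perm_comp_upt[unfolded One_nat_def] atLeastLessThanSuc_atLeastAtMost del: upt_Suc)
  have "perm_comp (perm_inv ?\<rho>) (perm_comp ?\<rho> \<sigma>) = \<sigma>"
    using \<rho> assms by (intro perm_comp_perm_inv_left) (auto simp: perm_words_iff)
  then show ?thesis
    unfolding id using perm_comp_upt[of "perm_inv ?\<rho>"] by simp
qed


section \<open>Words up to partial commutation\<close>

lemma perm_comp_append: "perm_comp w (\<alpha> @ \<beta>) = perm_comp w \<alpha> @ perm_comp w \<beta>"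
  by (simp add: perm_comp_def)

text \<open>
  The equivalence relation generated by these exchanges identifies words that agree as traces
  (elements of the partially commutative monoid) for the colouring \<open>c\<close>.
\<close>

definition swap_step :: "('a \<Rightarrow> 'c) \<Rightarrow> 'a list \<Rightarrow> 'a list \<Rightarrow> bool" where
  "swap_step c u v \<longleftrightarrow> (\<exists>A x y B. u = A @ x # y # B \<and> v = A @ y # x # B \<and> c x \<noteq> c y)"

definition trace_invariant :: "('a \<Rightarrow> 'c) \<Rightarrow> ('a list \<Rightarrow> 'b) \<Rightarrow> bool" where
  "trace_invariant c \<Phi> \<longleftrightarrow> (\<forall>u v. swap_step c u v \<longrightarrow> \<Phi> u = \<Phi> v)"

lemma swap_step_append: "swap_step c u v \<Longrightarrow> swap_step c (s @ u @ t) (s @ v @ t)"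
  unfolding swap_step_def by (metis append.assoc append_Cons)

lemma swap_steps_append: "(swap_step c)\<^sup>*\<^sup>* u v \<Longrightarrow> (swap_step c)\<^sup>*\<^sup>* (s @ u @ t) (s @ v @ t)"
  by (induction rule: rtranclp_induct) (auto intro: swap_step_append rtranclp.rtrancl_into_rtrancl)

lemma swap_steps_Cons: "(swap_step c)\<^sup>*\<^sup>* u v \<Longrightarrow> (swap_step c)\<^sup>*\<^sup>* (x # u) (x # v)"
  using swap_steps_append[of c u v "[x]" "[]"] by simp

lemma length_swap_step: "swap_step c u v \<Longrightarrow> length u = length v"
  by (auto simp: swap_step_def)

lemma trace_invariantD: "trace_invariant c \<Phi> \<Longrightarrow> swap_step c u v \<Longrightarrow> \<Phi> u = \<Phi> v"
  by (simp add: trace_invariant_def)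

lemma trace_invariant_steps:
  "(swap_step c)\<^sup>*\<^sup>* u v \<Longrightarrow> trace_invariant c \<Phi> \<Longrightarrow> \<Phi> u = \<Phi> v"
  by (induction rule: rtranclp_induct) (auto dest: trace_invariantD)

lemma swap_steps_move:
  "\<forall>y\<in>set F. c x \<noteq> c y \<Longrightarrow> (swap_step c)\<^sup>*\<^sup>* (x # F) (F @ [x])"
proof (induction F)
  case (Cons y F)
  have "swap_step c (x # y # F) (y # x # F)"
    unfolding swap_step_def using Cons.prems by (metis append_Nil list.set_intros(1))
  moreover have "(swap_step c)\<^sup>*\<^sup>* (y # x # F) (y # F @ [x])"
    using Cons by (intro swap_steps_Cons) auto
  ultimately show ?case by simp
qed simp

text \<open>
  The letters of one colour commute with all the others, so they can be collected in front.
\<close>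

lemma swap_steps_separate:
  "(swap_step c)\<^sup>*\<^sup>* u (filter (\<lambda>x. c x = a) u @ filter (\<lambda>x. c x \<noteq> a) u)"
proof (induction u)
  case (Cons x u)
  let ?F = "filter (\<lambda>x. c x = a) u" and ?G = "filter (\<lambda>x. c x \<noteq> a) u"
  have *: "(swap_step c)\<^sup>*\<^sup>* (x # u) (x # ?F @ ?G)"
    using Cons by (rule swap_steps_Cons)
  show ?case
  proof (cases "c x = a")
    case False
    then have "(swap_step c)\<^sup>*\<^sup>* (x # ?F) (?F @ [x])"
      by (intro swap_steps_move) auto
    from swap_steps_append[OF this, of "[]" ?G] * False show ?thesis
      by (auto intro: rtranclp_trans)
  qed (use * in simp)
qed simp

text \<open>
  Insertion sort moves a letter only past letters of a strictly smaller colour, so sorting by colour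
  does not change the trace.
\<close>

lemma swap_steps_sort_key: "(swap_step c)\<^sup>*\<^sup>* u (sort_key c u)"
proof (induction u)
  case (Cons x u)
  have "(swap_step c)\<^sup>*\<^sup>* (x # v) (insort_key c x v)" for v
  proof (induction v)
    case (Cons y v)
    show ?case
    proof (cases "c x \<le> c y")
      case False
      then have "swap_step c (x # y # v) (y # x # v)"
        unfolding swap_step_def by (metis append_Nil order_refl)
      with swap_steps_Cons[OF Cons, of y] False show ?thesis
        by (auto intro: converse_rtranclp_into_rtranclp)
    qed simp
  qed simp
  with swap_steps_Cons[OF Cons, of x] show ?case
    by (auto intro: rtranclp_trans)
qed simp


section \<open>Elements that respect partial commutation\<close>

text \<open>
  The letters of \<open>w\<close> are inserted into the component of \<open>H\<close> of degree \<^term>\<open>length w\<close>, seen as a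
  multilinear polynomial; since the result is only ever needed up to a test function \<open>\<Phi>\<close> on words,
  it is paired with \<open>\<Phi>\<close> at once.
\<close>

definition substitute :: "(nat list \<Rightarrow>\<^sub>0 'k::field) \<Rightarrow> nat list \<Rightarrow> (nat list \<Rightarrow> 'k) \<Rightarrow> 'k" where
  "substitute H w \<Phi> = pairing H (\<lambda>\<tau>. if length \<tau> = length w then \<Phi> (perm_comp w \<tau>) else 0)"

definition respects_traces :: "(nat list \<Rightarrow>\<^sub>0 'k::field) \<Rightarrow> bool" where
  "respects_traces H \<longleftrightarrow> (\<forall>c :: nat \<Rightarrow> nat. \<forall>\<Phi> u v.
     trace_invariant c \<Phi> \<longrightarrow> swap_step c u v \<longrightarrow> substitute H u \<Phi> = substitute H v \<Phi>)"

lemma respects_tracesD: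
  fixes c :: "nat \<Rightarrow> nat"
  shows "respects_traces H \<Longrightarrow> trace_invariant c \<Phi> \<Longrightarrow> swap_step c u v \<Longrightarrow>
    substitute H u \<Phi> = substitute H v \<Phi>"
  unfolding respects_traces_def by blast

lemma respects_traces_steps:
  fixes c :: "nat \<Rightarrow> nat"
  assumes "(swap_step c)\<^sup>*\<^sup>* u v" "respects_traces H" "trace_invariant c \<Phi>"
  shows "substitute H u \<Phi> = substitute H v \<Phi>"
  using assms(1)
proof (induction rule: rtranclp_induct)
  case (step y z)
  then show ?case using respects_tracesD[OF assms(2,3) step(2)] by simp
qed simp

lemma subspace_respects_traces: "fsv.subspace {H :: nat list \<Rightarrow>\<^sub>0 'k::field. respects_traces H}"
  by (rule fsv.subspaceI)
     (auto simp: respects_traces_def substitute_def pairing_add pairing_scale)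


section \<open>Unshuffling and products\<close>

text \<open>
  The pairs \<open>(u, v)\<close> run over all ways to distribute the letters of the word to two subwords,
  counted with multiplicity if letters repeat.
\<close>

fun unshuffle_sum :: "'a list \<Rightarrow> ('a list \<Rightarrow> 'a list \<Rightarrow> 'k::comm_monoid_add) \<Rightarrow> 'k" where
  "unshuffle_sum [] \<Psi> = \<Psi> [] []"
| "unshuffle_sum (x # w) \<Psi> =
     unshuffle_sum w (\<lambda>u v. \<Psi> (x # u) v) + unshuffle_sum w (\<lambda>u v. \<Psi> u (x # v))"

lemma unshuffle_sum_eq:
  "unshuffle_sum w \<Psi> = (\<Sum>T\<in>Pow {..<length w}. \<Psi> (nths w T) (nths w (- T)))"
proof (induction w arbitrary: \<Psi>)
  case (Cons x w)
  let ?P = "Pow {..<length w}"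
  have P: "Pow {..<length (x # w)} = (`) Suc ` ?P \<union> insert 0 ` (`) Suc ` ?P"
    by (simp add: lessThan_Suc_eq_insert_0 Pow_insert image_Pow_surj)
  have inj: "inj_on ((`) Suc) ?P" "inj_on (insert 0) ((`) Suc ` ?P)"
    by (auto simp: inj_on_def inj_image_eq_iff)
  have eq: "{j. Suc j \<in> Suc ` T} = T" "{j. Suc j \<notin> Suc ` T} = - T" for T :: "nat set"
    by auto
  have "(\<Sum>T\<in>Pow {..<length (x # w)}. \<Psi> (nths (x # w) T) (nths (x # w) (- T))) =
    (\<Sum>T\<in>?P. \<Psi> (nths w T) (x # nths w (- T))) + (\<Sum>T\<in>?P. \<Psi> (x # nths w T) (nths w (- T)))"
    unfolding P
    by (subst sum.union_disjoint)
       (auto simp: sum.reindex[OF inj(1)] sum.reindex[OF inj(2)] nths_Cons eq)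
  then show ?case by (simp add: Cons.IH add.commute)
qed simp

lemma unshuffle_sum_cong:
  "(\<And>u v. \<Psi> u v = \<Psi>' u v) \<Longrightarrow> unshuffle_sum w \<Psi> = unshuffle_sum w \<Psi>'"
  by (simp add: unshuffle_sum_eq)

text \<open>
  If the two exchanged letters go to different subwords, the distribution of both words gives the
  same pair \<open>(u, v)\<close>; otherwise one of \<open>u\<close> and \<open>v\<close> undergoes the exchange.
\<close>

lemma unshuffle_sum_swap_step:
  assumes "swap_step c w w'"
    and "\<And>u u' v. swap_step c u u' \<Longrightarrow> \<Psi> u v = \<Psi> u' v"
    and "\<And>u v v'. swap_step c v v' \<Longrightarrow> \<Psi> u v = \<Psi> u v'"
  shows "unshuffle_sum w \<Psi> = unshuffle_sum w' \<Psi>"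
proof -
  obtain A x y B where w: "w = A @ x # y # B" "w' = A @ y # x # B" "c x \<noteq> c y"
    using assms(1) by (auto simp: swap_step_def)
  have "unshuffle_sum (A @ x # y # B) \<Psi> = unshuffle_sum (A @ y # x # B) \<Psi>"
    using assms(2,3)
  proof (induction A arbitrary: \<Psi>)
    case Nil
    have "swap_step c (x # y # u) (y # x # u)" for u
      unfolding swap_step_def using w(3) by (metis append_Nil)
    then have "(\<lambda>u. \<Psi> (x # y # u)) = (\<lambda>u. \<Psi> (y # x # u))"
      "(\<lambda>u v. \<Psi> u (x # y # v)) = (\<lambda>u v. \<Psi> u (y # x # v))"
      using Nil by (auto intro!: ext)
    then show ?case by (simp add: algebra_simps)
  next
    case (Cons z A)
    have step: "swap_step c (z # u) (z # v)" if "swap_step c u v" for u v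
      using swap_step_append[OF that, of "[z]" "[]"] by simp
    show ?case
      using Cons.IH[of "\<lambda>u v. \<Psi> (z # u) v"] Cons.IH[of "\<lambda>u v. \<Psi> u (z # v)"] Cons.prems step
      by simp
  qed
  then show ?thesis by (simp add: w)
qed

lemma pairing_unshuffle_sum:
  "pairing f (\<lambda>x. unshuffle_sum w (\<Psi> x)) = unshuffle_sum w (\<lambda>u v. pairing f (\<lambda>x. \<Psi> x u v))"
  by (simp add: unshuffle_sum_eq pairing_fun_sum)

text \<open>
  A permutation \<open>\<gamma> = u v\<close> in the product of \<open>\<alpha>\<close> and \<open>\<beta>\<close> is determined by the set of letters of \<open>u\<close>:
  \<open>u\<close> lists these letters in the order type \<open>\<alpha>\<close>, and \<open>v\<close> the remaining ones in the order type \<open>\<beta>\<close>.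
  Inserting \<open>w\<close> replaces letters by the positions of \<open>w\<close> that they name, so the set of letters of \<open>u\<close>
  becomes the set of positions of a subword of \<open>w\<close>.
\<close>

lemma sum_convolution:
  assumes \<alpha>: "\<alpha> \<in> perm_words" and \<beta>: "\<beta> \<in> perm_words"
  shows "(\<Sum>\<gamma>\<in>convolution \<alpha> \<beta>. if length \<gamma> = length w then \<Phi> (perm_comp w \<gamma>) else 0) =
    unshuffle_sum w (\<lambda>u v. if length u = length \<alpha> \<and> length v = length \<beta>
      then \<Phi> (perm_comp u \<alpha> @ perm_comp v \<beta>) else (0 :: 'b::comm_monoid_add))"
proof (cases "length \<alpha> + length \<beta> = length w")
  case False
  have "length (nths w T) + length (nths w (- T)) = length w" for T
  proof -
    have "length (nths w T) + length (nths w (- T)) =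
        card ({i. i < length w \<and> i \<in> T} \<union> {i. i < length w \<and> i \<notin> T})"
      unfolding length_nths by (subst card_Un_disjoint) auto
    also have "{i. i < length w \<and> i \<in> T} \<union> {i. i < length w \<and> i \<notin> T} = {..<length w}" by auto
    finally show ?thesis by simp
  qed
  then have "length (nths w T) = length \<alpha> \<Longrightarrow> length (nths w (- T)) \<noteq> length \<beta>" for T
    using False by metis
  then have "unshuffle_sum w (\<lambda>u v. if length u = length \<alpha> \<and> length v = length \<beta>
      then \<Phi> (perm_comp u \<alpha> @ perm_comp v \<beta>) else 0) = 0"
    unfolding unshuffle_sum_eq by (intro sum.neutral) auto
  moreover have "length \<gamma> \<noteq> length w" if "\<gamma> \<in> convolution \<alpha> \<beta>" for \<gamma>
    using that False by (auto simp: convolution_def)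
  ultimately show ?thesis by simp
next
  case True
  define I where "I = [1..<Suc (length w)]"
  have I: "length I = length w" "sorted I" "distinct I" "perm_comp w I = w"
    and nthI: "\<And>i. i < length w \<Longrightarrow> I ! i = Suc i"
    unfolding I_def by (simp_all add: perm_comp_upt[unfolded One_nat_def] del: upt_Suc)
  let ?Q = "\<lambda>T. length (nths w T) = length \<alpha> \<and> length (nths w (- T)) = length \<beta>"
  let ?S = "{T \<in> Pow {..<length w}. ?Q T}"
  define word where "word T = perm_comp (nths I T) \<alpha> @ perm_comp (nths I (- T)) \<beta>" for T
  \<comment> \<open>\<open>word\<close> turns a set of positions into a permutation, and \<open>places\<close> is its inverse; positions
    count from 0 and letters from 1.\<close>
  define places where "places \<gamma> = {i. Suc i \<in> set (take (length \<alpha>) \<gamma>)}" for \<gamma> :: "nat list"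
  have len: "length (nths I T) = length (nths w T)" for T
    by (simp add: length_nths I)
  have setI: "set (nths I T) = {x. x - 1 \<in> T \<and> 1 \<le> x \<and> x \<le> length w}" for T
  proof -
    have "set (nths I T) = {I ! i | i. i < length w \<and> i \<in> T}"
      by (simp add: set_nths I)
    also have "\<dots> = Suc ` {i. i < length w \<and> i \<in> T}"
      unfolding image_Collect by (rule Collect_cong) (metis nthI)
    also have "\<dots> = {x. x - 1 \<in> T \<and> 1 \<le> x \<and> x \<le> length w}"
      by (auto simp: image_iff) (metis Suc_pred Suc_le_lessD Suc_le_eq)
    finally show ?thesis .
  qed
  have dist: "distinct (nths I T)" and srt: "sorted (nths I T)" for T
    by (simp_all add: I sorted_nths)
  have "(\<Sum>T\<in>?S. \<Phi> (perm_comp (nths w T) \<alpha> @ perm_comp (nths w (- T)) \<beta>)) =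
    (\<Sum>\<gamma>\<in>convolution \<alpha> \<beta>. \<Phi> (perm_comp w \<gamma>))"
  proof (rule sum.reindex_bij_witness[where i = places and j = word])
    fix T assume T: "T \<in> ?S"
    have l: "length \<alpha> = length (nths I T)" "length \<beta> = length (nths I (- T))"
      using T by (simp_all add: len)
    have st: "set (perm_comp (nths I T) \<alpha>) = set (nths I T)"
      "set (perm_comp (nths I (- T)) \<beta>) = set (nths I (- T))"
      using \<alpha> \<beta> l by (intro set_perm_comp; simp)+
    show "places (word T) = T"
      using T by (auto simp: places_def word_def st setI)
    have "distinct (word T)"
      using \<alpha> \<beta> l dist by (auto simp: word_def st setI distinct_perm_comp)
    moreover have "set (word T) = {1..length w}"
      by (auto simp: word_def st setI)
    ultimately have "word T \<in> perm_words" by (rule perm_wordsI)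
    moreover have "std (perm_comp (nths I T) \<alpha>) = \<alpha>" "std (perm_comp (nths I (- T)) \<beta>) = \<beta>"
      using \<alpha> \<beta> l dist srt by (auto intro: std_perm_comp_sorted)
    ultimately show "word T \<in> convolution \<alpha> \<beta>"
      unfolding convolution_def word_def by blast
    have nths: "perm_comp w (perm_comp (nths I T') \<sigma>) = perm_comp (nths w T') \<sigma>"
      if "\<sigma> \<in> perm_words" "length \<sigma> = length (nths I T')" for T' \<sigma>
    proof -
      have "perm_comp w (nths I T') = nths w T'"
        using I(4) by (simp only: perm_comp_def nths_map[symmetric])
      then show ?thesis using that by (subst perm_comp_assoc) (simp_all add: perm_words_iff)
    qed
    show "\<Phi> (perm_comp w (word T)) = \<Phi> (perm_comp (nths w T) \<alpha> @ perm_comp (nths w (- T)) \<beta>)"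
      using nths[OF \<alpha> l(1)] nths[OF \<beta> l(2)] by (simp add: word_def perm_comp_append)
  next
    fix \<gamma> assume "\<gamma> \<in> convolution \<alpha> \<beta>"
    then obtain u v where \<gamma>: "\<gamma> \<in> perm_words" "\<gamma> = u @ v" "std u = \<alpha>" "std v = \<beta>"
      by (auto simp: convolution_def)
    have l: "length u = length \<alpha>" "length v = length \<beta>" using \<gamma> by auto
    have s: "distinct u" "distinct v" "set u \<inter> set v = {}" "set u \<union> set v = {1..length w}"
      using \<gamma> l True by (auto simp: perm_words_iff)
    have pl: "places \<gamma> = {i. Suc i \<in> set u}" by (simp add: places_def \<gamma>(2) l)
    have mem: "x - 1 \<in> places \<gamma> \<and> 1 \<le> x \<and> x \<le> length w \<longleftrightarrow> x \<in> set u"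
      "x - 1 \<in> - places \<gamma> \<and> 1 \<le> x \<and> x \<le> length w \<longleftrightarrow> x \<in> set v" for x
    proof -
      have "x \<in> set u \<or> x \<in> set v \<longleftrightarrow> 1 \<le> x \<and> x \<le> length w"
        using s(4) by (metis Un_iff atLeastAtMost_iff)
      moreover have "1 \<le> x \<Longrightarrow> x - 1 \<in> places \<gamma> \<longleftrightarrow> x \<in> set u" by (simp add: pl)
      moreover have "x \<in> set u \<Longrightarrow> x \<notin> set v" using s(3) by blast
      ultimately show "x - 1 \<in> places \<gamma> \<and> 1 \<le> x \<and> x \<le> length w \<longleftrightarrow> x \<in> set u"
        "x - 1 \<in> - places \<gamma> \<and> 1 \<le> x \<and> x \<le> length w \<longleftrightarrow> x \<in> set v"
        unfolding Compl_iff by metis+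
    qed
    have sets: "set (nths I (places \<gamma>)) = set u" "set (nths I (- places \<gamma>)) = set v"
      unfolding setI mem by simp_all
    have nths: "nths I (places \<gamma>) = sort u" "nths I (- places \<gamma>) = sort v"
      by (rule sorted_distinct_set_unique; use dist srt s in \<open>simp add: sets\<close>)+
    have "length (nths w (places \<gamma>)) = length \<alpha>" "length (nths w (- places \<gamma>)) = length \<beta>"
      unfolding len[symmetric] nths by (simp_all add: l)
    moreover have "places \<gamma> \<subseteq> {..<length w}"
    proof
      fix i assume "i \<in> places \<gamma>"
      then have "Suc i \<in> set u" by (simp add: pl)
      then have "Suc i \<le> length w" using mem(1)[of "Suc i"] by blast
      then show "i \<in> {..<length w}" by simp
    qed
    ultimately show "places \<gamma> \<in> ?S" by simp
    show "word (places \<gamma>) = \<gamma>"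
      unfolding word_def nths using s by (simp add: perm_comp_sort_std \<gamma>(2) flip: \<gamma>(3,4))
  qed
  moreover have "length \<gamma> = length w" if "\<gamma> \<in> convolution \<alpha> \<beta>" for \<gamma>
    using that True by (auto simp: convolution_def)
  ultimately show ?thesis
    by (simp add: unshuffle_sum_eq sum.inter_filter[symmetric])
qed

lemma substitute_fq_mult:
  assumes "f \<in> FQSym" "g \<in> FQSym"
  shows "substitute (fq_mult f g) w \<Phi> =
    unshuffle_sum w (\<lambda>u v. substitute f u (\<lambda>s. substitute g v (\<lambda>t. \<Phi> (s @ t))))"
proof -
  have "substitute (fq_mult f g) w \<Phi> = pairing f (\<lambda>\<alpha>. pairing g (\<lambda>\<beta>.
      unshuffle_sum w (\<lambda>u v. if length u = length \<alpha> \<and> length v = length \<beta>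
        then \<Phi> (perm_comp u \<alpha> @ perm_comp v \<beta>) else 0)))"
    unfolding substitute_def pairing_fq_mult
    using assms by (intro pairing_cong sum_convolution) (auto simp: FQSym_def)
  also have "\<dots> = unshuffle_sum w (\<lambda>u v. substitute f u (\<lambda>s. substitute g v (\<lambda>t. \<Phi> (s @ t))))"
    unfolding pairing_unshuffle_sum substitute_def
    by (intro unshuffle_sum_cong pairing_cong) (auto intro!: pairing_cong)
  finally show ?thesis .
qed

lemma respects_traces_fq_mult:
  fixes f g :: "nat list \<Rightarrow>\<^sub>0 'k::field"
  assumes "f \<in> FQSym" "g \<in> FQSym" "respects_traces f" "respects_traces g"
  shows "respects_traces (fq_mult f g)"
  unfolding respects_traces_def
proof (intro allI impI)
  fix c :: "nat \<Rightarrow> nat" and \<Phi> :: "nat list \<Rightarrow> 'k" and w w'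
  assume \<Phi>: "trace_invariant c \<Phi>" and step: "swap_step c w w'"
  have left: "trace_invariant c (\<lambda>s. substitute g v (\<lambda>t. \<Phi> (s @ t)))" for v
    unfolding trace_invariant_def
  proof (intro allI impI)
    fix s s' assume "swap_step c s s'"
    then have "\<Phi> (s @ t) = \<Phi> (s' @ t)" for t
      using trace_invariantD[OF \<Phi>] swap_step_append[of c s s' "[]" t] by simp
    then show "substitute g v (\<lambda>t. \<Phi> (s @ t)) = substitute g v (\<lambda>t. \<Phi> (s' @ t))" by simp
  qed
  have right: "trace_invariant c (\<lambda>t. \<Phi> (s @ t))" for s
    unfolding trace_invariant_def
    using trace_invariantD[OF \<Phi>] swap_step_append[of c _ _ s "[]"] by simp
  show "substitute (fq_mult f g) w \<Phi> = substitute (fq_mult f g) w' \<Phi>"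
    unfolding substitute_fq_mult[OF assms(1,2)]
  proof (rule unshuffle_sum_swap_step[OF step])
    show "substitute f u (\<lambda>s. substitute g v (\<lambda>t. \<Phi> (s @ t))) =
        substitute f u' (\<lambda>s. substitute g v (\<lambda>t. \<Phi> (s @ t)))" if "swap_step c u u'" for u u' v
      using assms(3) left that by (rule respects_tracesD)
    show "substitute f u (\<lambda>s. substitute g v (\<lambda>t. \<Phi> (s @ t))) =
        substitute f u (\<lambda>s. substitute g v' (\<lambda>t. \<Phi> (s @ t)))" if "swap_step c v v'" for u v v'
      using respects_tracesD[OF assms(4) right that] by simp
  qed
qed

lemma respects_traces_one: "respects_traces (bG [])"
  by (auto simp: respects_traces_def substitute_def perm_comp_def dest: length_swap_step)

lemma fq_mult_in_FQSym: "fq_mult f g \<in> FQSym"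
proof -
  have "Poly_Mapping.lookup (fq_mult f g) \<gamma> = 0" if "\<gamma> \<notin> perm_words" for \<gamma>
  proof -
    have "(\<Sum>\<delta>\<in>convolution \<alpha> \<beta>. if \<delta> = \<gamma> then 1 else 0) = (0 :: 'a)" for \<alpha> \<beta>
      using that by (intro sum.neutral) (auto simp: convolution_def)
    then show ?thesis
      by (simp add: lookup_eq_pairing pairing_fq_mult)
  qed
  then show ?thesis by (auto simp: FQSym_def in_keys_iff)
qed

lemma one_in_FQSym: "bG [] \<in> FQSym"
  by (simp add: FQSym_def bG_def perm_words_iff)

lemma fq_prod_in_FQSym: "fq_prod Fs \<in> FQSym"
  by (cases Fs) (simp_all add: fq_prod_Cons fq_mult_in_FQSym one_in_FQSym, simp add: fq_prod_def one_in_FQSym)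


section \<open>Lie elements\<close>

text \<open>
  The unshuffling coproduct sends a word to the tensor product of its subword of letters in \<open>S\<close> and
  its subword of letters outside \<open>S\<close>. An element is primitive for it if it has no constant term and
  its image has no component with both factors nonempty; the latter is tested by the functions \<open>\<psi>\<close>
  that vanish as soon as one argument is empty.
\<close>

definition primitive :: "nat set \<Rightarrow> (nat list \<Rightarrow>\<^sub>0 'k::field) set" where
  "primitive S = {p. Poly_Mapping.lookup p [] = 0 \<and>
     (\<forall>\<psi>. (\<forall>v. \<psi> [] v = 0) \<longrightarrow> (\<forall>u. \<psi> u [] = 0) \<longrightarrow>
        pairing p (\<lambda>w. \<psi> (filter (\<lambda>x. x \<in> S) w) (filter (\<lambda>x. x \<notin> S) w)) = 0)}"

text \<open>
  This is the equation \<open>\<Delta> p = p\<^sub>S \<otimes> 1 + 1 \<otimes> p\<^sub>-\<^sub>S\<close>, tested by an arbitrary function.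
\<close>

lemma pairing_primitive:
  fixes p :: "nat list \<Rightarrow>\<^sub>0 'k::field"
  assumes "p \<in> primitive S"
  shows "pairing p (\<lambda>w. \<psi> (filter (\<lambda>x. x \<in> S) w) (filter (\<lambda>x. x \<notin> S) w)) =
    pairing p (\<lambda>w. if set w \<subseteq> S then \<psi> w [] else 0) +
    pairing p (\<lambda>w. if set w \<subseteq> - S then \<psi> [] w else 0)"
proof -
  let ?in = "filter (\<lambda>x. x \<in> S)" and ?out = "filter (\<lambda>x. x \<notin> S)"
  define \<psi>' where "\<psi>' u v = (if u = [] \<or> v = [] then 0 else \<psi> u v)" for u v
  have "pairing p (\<lambda>w. \<psi>' (?in w) (?out w)) = 0"
  proof -
    have "\<forall>v. \<psi>' [] v = 0" "\<forall>u. \<psi>' u [] = 0" by (simp_all add: \<psi>'_def)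
    then show ?thesis using assms unfolding primitive_def by blast
  qed
  moreover have "pairing p (\<lambda>w. if w = [] then 1 else 0) = 0"
    using assms by (simp add: primitive_def lookup_eq_pairing)
  moreover have "\<psi> (?in w) (?out w) =
      \<psi>' (?in w) (?out w) + ((if set w \<subseteq> S then \<psi> w [] else 0) + (if set w \<subseteq> - S then \<psi> [] w else 0))
      + (- \<psi> [] []) * (if w = [] then 1 else 0)" for w
  proof -
    have "?in w = [] \<longleftrightarrow> set w \<subseteq> - S" "?out w = [] \<longleftrightarrow> set w \<subseteq> S"
      by (auto simp: filter_empty_conv)
    moreover have "?in w = w" if "set w \<subseteq> S" using that by (simp add: subset_iff)
    moreover have "?out w = w" if "set w \<subseteq> - S" using that by (simp add: subset_iff)
    moreover have "w = []" if "set w \<subseteq> S" "set w \<subseteq> - S" using that by (cases w) auto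
    ultimately show ?thesis by (auto simp: \<psi>'_def)
  qed
  ultimately show ?thesis
    by (simp only: pairing_fun_add pairing_fun_scale) simp
qed

text \<open>
  Primitive elements contain the letters and are closed under brackets: in the coproduct of
  \<open>p q\<close> the mixed terms are \<open>p\<^sub>S \<otimes> q\<^sub>-\<^sub>S + q\<^sub>S \<otimes> p\<^sub>-\<^sub>S\<close>, which is symmetric in \<open>p\<close> and \<open>q\<close> and cancels
  in the commutator.
\<close>

lemma free_lie_primitive: "(free_lie j :: (nat list \<Rightarrow>\<^sub>0 'k::field) set) \<subseteq> primitive S"
proof -
  let ?in = "filter (\<lambda>x. x \<in> S)" and ?out = "filter (\<lambda>x. x \<notin> S)"
  have sub: "fsv.subspace (primitive S :: (nat list \<Rightarrow>\<^sub>0 'k::field) set)"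
    by (rule fsv.subspaceI) (auto simp: primitive_def pairing_add pairing_scale lookup_add)
  have letters: "Poly_Mapping.single [i] 1 \<in> (primitive S :: (nat list \<Rightarrow>\<^sub>0 'k::field) set)" for i
    by (auto simp: primitive_def lookup_single)
  have bracket: "concat_mult p q - concat_mult q p \<in> primitive S"
    if p: "p \<in> primitive S" and q: "q \<in> primitive S" for p q :: "nat list \<Rightarrow>\<^sub>0 'k"
  proof -
    have "Poly_Mapping.lookup (concat_mult p q) [] = 0" if "p \<in> primitive S" for p q :: "nat list \<Rightarrow>\<^sub>0 'k"
    proof -
      have "Poly_Mapping.lookup (concat_mult p q) [] =
          pairing p (\<lambda>u. Poly_Mapping.lookup q [] * (if u = [] then 1 else 0))"
        unfolding lookup_eq_pairing[of "concat_mult p q"] pairing_concat_mult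
        by (rule pairing_cong) (simp add: lookup_eq_pairing)
      then show ?thesis
        using that unfolding pairing_fun_scale by (simp add: primitive_def lookup_eq_pairing)
    qed
    then have one: "Poly_Mapping.lookup (concat_mult p q - concat_mult q p) [] = 0"
      using p q by (simp add: lookup_minus)
    have mult: "pairing (concat_mult p q) (\<lambda>w. \<psi> (?in w) (?out w)) =
        pairing p (\<lambda>u. if set u \<subseteq> S then pairing q (\<lambda>v. if set v \<subseteq> - S then \<psi> u v else 0) else 0) +
        pairing p (\<lambda>u. if set u \<subseteq> - S then pairing q (\<lambda>v. if set v \<subseteq> S then \<psi> v u else 0) else 0)"
      if p: "p \<in> primitive S" and q: "q \<in> primitive S"
        and \<psi>: "\<forall>v. \<psi> [] v = 0" "\<forall>u. \<psi> u [] = 0"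
      for \<psi> and p q :: "nat list \<Rightarrow>\<^sub>0 'k"
    proof -
      have left: "pairing q (\<lambda>v. \<psi> (u @ ?in v) (?out v)) =
          pairing q (\<lambda>v. if set v \<subseteq> - S then \<psi> u v else 0)" for u
        using pairing_primitive[OF q, of "\<lambda>a b. \<psi> (u @ a) b"] \<psi> by (simp cong: if_cong)
      have right: "pairing q (\<lambda>v. \<psi> (?in v) (u @ ?out v)) =
          pairing q (\<lambda>v. if set v \<subseteq> S then \<psi> v u else 0)" for u
        using pairing_primitive[OF q, of "\<lambda>a b. \<psi> a (u @ b)"] \<psi> by (simp cong: if_cong)
      have "pairing (concat_mult p q) (\<lambda>w. \<psi> (?in w) (?out w)) =
        pairing p (\<lambda>u. (\<lambda>u1 u2. pairing q (\<lambda>v. \<psi> (u1 @ ?in v) (u2 @ ?out v))) (?in u) (?out u))"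
        by (simp add: pairing_concat_mult)
      also have "\<dots> =
        pairing p (\<lambda>u. if set u \<subseteq> S then pairing q (\<lambda>v. \<psi> (u @ ?in v) (?out v)) else 0) +
        pairing p (\<lambda>u. if set u \<subseteq> - S then pairing q (\<lambda>v. \<psi> (?in v) (u @ ?out v)) else 0)"
        by (subst pairing_primitive[OF p]) (simp cong: if_cong)
      finally show ?thesis unfolding left right .
    qed
    have "pairing (concat_mult p q - concat_mult q p) (\<lambda>w. \<psi> (?in w) (?out w)) = 0"
      if \<psi>: "\<forall>v. \<psi> [] v = 0" "\<forall>u. \<psi> u [] = 0" for \<psi>
    proof -
      have cross: "pairing p (\<lambda>u. if set u \<subseteq> A then pairing q (\<lambda>v. if set v \<subseteq> B then \<chi> u v else 0) else 0) =
          pairing q (\<lambda>v. if set v \<subseteq> B then pairing p (\<lambda>u. if set u \<subseteq> A then \<chi> u v else 0) else 0)"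
        for A B and \<chi> :: "nat list \<Rightarrow> nat list \<Rightarrow> 'k"
        unfolding pairing_if[symmetric]
        by (subst pairing_swap) (auto intro!: pairing_cong)
      show ?thesis
        unfolding pairing_diff mult[OF p q \<psi>] mult[OF q p \<psi>]
        using cross[of S "- S" \<psi>] cross[of "- S" S "\<lambda>u v. \<psi> v u"] by simp
    qed
    with one show ?thesis by (simp add: primitive_def)
  qed
  show ?thesis
    unfolding free_lie_def using sub letters bracket by (intro Inter_lower) auto
qed

text \<open>
  Let \<open>x\<close> and \<open>y\<close> be letters of different colours. Separating the colour of \<open>x\<close> from the other colours
  turns the test function into one that depends only on the two subwords of a permutation \<open>\<tau>\<close>,
  given by the places with the colour of \<open>x\<close> and by the other places. Neither is empty, so a
  primitive element pairs to zero with it, before and after the exchange.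
\<close>

lemma respects_traces_Lie:
  fixes p :: "nat list \<Rightarrow>\<^sub>0 'k::field"
  assumes "p \<in> Lie j"
  shows "respects_traces p"
proof -
  have keys: "set \<tau> = {1..j}" "length \<tau> = j" if "\<tau> \<in> Poly_Mapping.keys p" for \<tau>
  proof -
    have "\<tau> \<in> permutations_of_set {1..j}" using that assms by (auto simp: Lie_def)
    then show "set \<tau> = {1..j}" "length \<tau> = j"
      using length_finite_permutations_of_set[of \<tau> "{1..j}"] by (simp_all add: permutations_of_set_def)
  qed
  have zero: "substitute p (A @ x # y # B) \<Phi> = 0"
    if \<Phi>: "trace_invariant c \<Phi>" and xy: "c x \<noteq> c y"
    for c :: "nat \<Rightarrow> nat" and \<Phi> A x y B
  proof (cases "j = length (A @ x # y # B)")
    case False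
    then show ?thesis
      unfolding substitute_def
      by (subst pairing_cong[where \<psi> = "\<lambda>_. 0"]) (auto simp: keys)
  next
    case True
    let ?w = "A @ x # y # B"
    \<comment> \<open>The letters of \<open>p\<close> name places in the word; \<open>S\<close> is the set of places with the colour of \<open>x\<close>.\<close>
    define S where "S = {i. c (?w ! (i - 1)) = c x}"
    define \<psi> where "\<psi> u v = (if u = [] \<or> v = [] then 0 else \<Phi> (perm_comp ?w (u @ v)))" for u v
    have "substitute p ?w \<Phi> = pairing p (\<lambda>\<tau>. \<psi> (filter (\<lambda>i. i \<in> S) \<tau>) (filter (\<lambda>i. i \<notin> S) \<tau>))"
      unfolding substitute_def
    proof (rule pairing_cong)
      fix \<tau> assume \<tau>: "\<tau> \<in> Poly_Mapping.keys p"
      let ?in = "filter (\<lambda>i. i \<in> S) \<tau>" and ?out = "filter (\<lambda>i. i \<notin> S) \<tau>"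
      have "perm_comp ?w ?in = filter (\<lambda>z. c z = c x) (perm_comp ?w \<tau>)"
        "perm_comp ?w ?out = filter (\<lambda>z. c z \<noteq> c x) (perm_comp ?w \<tau>)"
        by (simp_all add: perm_comp_def filter_map S_def o_def)
      then have "\<Phi> (perm_comp ?w \<tau>) = \<Phi> (perm_comp ?w (?in @ ?out))"
        using trace_invariant_steps[OF swap_steps_separate \<Phi>] by (simp only: perm_comp_append)
      moreover have "length A + 1 \<in> set ?in" "length A + 2 \<in> set ?out"
        using xy True by (auto simp: S_def keys[OF \<tau>] nth_append)
      then have "?in \<noteq> []" "?out \<noteq> []" by (metis empty_iff empty_set)+
      ultimately show "(if length \<tau> = length ?w then \<Phi> (perm_comp ?w \<tau>) else 0) = \<psi> ?in ?out"
        using True keys[OF \<tau>] by (simp add: \<psi>_def)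
    qed
    also have "\<dots> = 0"
    proof -
      have "p \<in> primitive S" using assms free_lie_primitive[of j S] by (auto simp: Lie_def)
      moreover have "\<forall>v. \<psi> [] v = 0" "\<forall>u. \<psi> u [] = 0" by (simp_all add: \<psi>_def)
      ultimately show ?thesis unfolding primitive_def by blast
    qed
    finally show ?thesis .
  qed
  show ?thesis
    unfolding respects_traces_def swap_step_def by (auto simp: zero)
qed

lemma PR_algebra_respects_traces:
  assumes "H \<in> PR_algebra"
  shows "respects_traces H"
proof -
  have "respects_traces (fq_prod ps)"
    if "\<forall>p\<in>set ps. \<exists>j\<ge>1. p \<in> Lie j" for ps :: "(nat list \<Rightarrow>\<^sub>0 'a) list"
    using that
  proof (induction ps)
    case Nil
    then show ?case by (simp add: fq_prod_def respects_traces_one)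
  next
    case (Cons p ps)
    then have "p \<in> FQSym" "respects_traces p"
      by (auto simp: Lie_def FQSym_def perm_words_def intro: respects_traces_Lie)
    with Cons show ?case
      by (auto simp: fq_prod_Cons intro: respects_traces_fq_mult fq_prod_in_FQSym)
  qed
  then have "{fq_prod (map (linear_ext bG) ps) | ps. \<forall>p\<in>set ps. \<exists>j\<ge>1. p \<in> Lie j} \<subseteq>
      {H :: nat list \<Rightarrow>\<^sub>0 'a. respects_traces H}"
    by (auto simp: linear_ext_bG)
  from fsv.span_minimal[OF this subspace_respects_traces] assms show ?thesis
    by (auto simp: PR_algebra_def)
qed

lemma PR_algebra_FQSym:
  assumes "H \<in> PR_algebra"
  shows "H \<in> FQSym"
proof -
  have "fsv.subspace (FQSym :: (nat list \<Rightarrow>\<^sub>0 'a) set)"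
  proof (rule fsv.subspaceI)
    fix f g :: "nat list \<Rightarrow>\<^sub>0 'a" assume "f \<in> FQSym" "g \<in> FQSym"
    then show "f + g \<in> FQSym" using keys_add[of f g] by (auto simp: FQSym_def)
  qed (auto simp: FQSym_def in_keys_iff)
  moreover have "{fq_prod (map (linear_ext bG) ps) | ps. \<forall>p\<in>set ps. \<exists>j\<ge>1. p \<in> Lie j} \<subseteq>
      (FQSym :: (nat list \<Rightarrow>\<^sub>0 'a) set)"
    by (auto simp: fq_prod_in_FQSym)
  ultimately show ?thesis
    using fsv.span_minimal assms unfolding PR_algebra_def by blast
qed


section \<open>Products of several basis elements\<close>

fun cut_word :: "nat list \<Rightarrow> 'a list \<Rightarrow> 'a list list" where
  "cut_word [] w = []"
| "cut_word (k # ks) w = take k w # cut_word ks (drop k w)"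

lemma length_cut [simp]: "length (cut_word ks w) = length ks"
  by (induction ks arbitrary: w) auto

lemma cut_map: "cut_word ks (map f w) = map (map f) (cut_word ks w)"
  by (induction ks arbitrary: w) (auto simp: take_map drop_map)

lemma concat_cut: "sum_list ks = length w \<Longrightarrow> concat (cut_word ks w) = w"
  by (induction ks arbitrary: w) auto

lemma map_length_cut: "sum_list ks = length w \<Longrightarrow> map length (cut_word ks w) = ks"
  by (induction ks arbitrary: w) auto

lemma cut_concat: "cut_word (map length bs) (concat bs) = bs"
  by (induction bs) auto

text \<open>
  In the realization by power series the product is concatenation, so the coefficient of a word in
  \<open>G\<^sub>\<beta>\<^sub>1 \<cdots> G\<^sub>\<beta>\<^sub>s\<close> is found by cutting it into parts of the lengths of the \<open>\<beta>\<^sub>i\<close>.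
\<close>

lemma realize_fq_prod:
  "realize (fq_prod (map bG \<beta>s)) w =
    (if sum_list (map length \<beta>s) = length w \<and> map std (cut_word (map length \<beta>s) w) = \<beta>s then 1 else (0 :: 'k::field))"
proof (induction \<beta>s arbitrary: w)
  case Nil
  have "std w = [] \<longleftrightarrow> w = []" by (metis length_0_conv length_std)
  then show ?case by (simp add: fq_prod_def realize_G)
next
  case (Cons \<beta> \<beta>s)
  let ?R = "\<lambda>w. realize (fq_prod (map bG \<beta>s)) w :: 'k"
  have "realize (fq_prod (map bG (\<beta> # \<beta>s))) w =
      (\<Sum>k\<le>length w. realize (bG \<beta>) (take k w) * ?R (drop k w))"
    by (simp add: fq_prod_Cons realize_mult)
  also have "\<dots> = (\<Sum>k\<le>length w. if k = length \<beta> then if std (take k w) = \<beta> then ?R (drop k w) else 0 else 0)"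
    by (rule sum.cong) (auto simp: realize_G)
  also have "\<dots> = (if length \<beta> \<le> length w \<and> std (take (length \<beta>) w) = \<beta> then ?R (drop (length \<beta>) w) else 0)"
    by simp
  finally show ?case by (auto simp: Cons.IH)
qed

lemma lookup_fq_prod:
  assumes "\<gamma> \<in> perm_words"
  shows "Poly_Mapping.lookup (fq_prod (map bG \<beta>s)) \<gamma> =
    (if sum_list (map length \<beta>s) = length \<gamma> \<and> map std (cut_word (map length \<beta>s) \<gamma>) = \<beta>s then 1 else (0 :: 'k::field))"
  using realize_fq_prod[of \<beta>s \<gamma>] assms by (simp add: realize_def)


section \<open>The iterated coproduct\<close>

lemma pairing_coprod_first:
  "pairing (coprod_first Y) \<psi> = pairing Y (\<lambda>\<sigma>s. \<Sum>(u, v)\<in>{(u, v). u @ v = perm_inv (hd \<sigma>s)}.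
     \<psi> (perm_inv (std u) # perm_inv (std v) # tl \<sigma>s))"
  unfolding coprod_first_def pairing_linear_ext pairing_tensor coprod_def pairing_bG pairing_sum
    pairing_pure_tensor_bG
  by (intro pairing_cong sum.cong) (auto simp: bF_def pairing_sum)

text \<open>
  Rules out the empty list, where \<^const>\<open>coprod_first\<close> would read its junk head.
\<close>

lemma lookup_coprod_iter_Nil: "Poly_Mapping.lookup (coprod_iter r H) [] = 0"
  by (cases "r - 1") (simp_all add: coprod_iter_def lookup_eq_pairing pairing_tensor1 pairing_coprod_first)

lemma sum_factorizations:
  assumes "\<And>u v. length u \<noteq> a \<or> length v \<noteq> b \<Longrightarrow> \<phi> u v = 0"
  shows "(\<Sum>(u, v)\<in>{(u, v). u @ v = w}. \<phi> u v) =
    (if length w = a + b then \<phi> (take a w) (drop a w) else (0 :: 'b::comm_monoid_add))"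
proof (cases "length w = a + b")
  case True
  have "(\<Sum>(u, v)\<in>{(u, v). u @ v = w}. \<phi> u v) = (\<Sum>(u, v)\<in>{(take a w, drop a w)}. \<phi> u v)"
    by (rule sum.mono_neutral_right[OF finite_factorizations]) (auto intro!: assms)
  then show ?thesis using True by simp
next
  case False
  then show ?thesis by (auto intro!: sum.neutral assms)
qed

text \<open>
  On inverse permutations the coproduct cuts a word into two and standardizes the parts, so the
  iterated coproduct cuts it into several parts; only the cut into parts of lengths \<open>ks\<close> is seen by
  a test function that is supported on that multidegree. The iteration always splits the first
  tensor factor, so the induction splits the first part, of length \<open>a + b\<close>, into parts of lengths
  \<open>a\<close> and \<open>b\<close>.
\<close>

lemma pairing_coprod_iter:
  assumes "H \<in> FQSym" "ks \<noteq> []" "\<And>\<rho>s. map length \<rho>s \<noteq> ks \<Longrightarrow> G \<rho>s = 0"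
  shows "pairing (coprod_iter (length ks) H) G = pairing H (\<lambda>\<tau>. if length \<tau> = sum_list ks
    then G (map (\<lambda>e. perm_inv (std e)) (cut_word ks (perm_inv \<tau>))) else 0)"
  using assms(2,3)
proof (induction "length ks" arbitrary: ks G)
  case (Suc n)
  show ?case
  proof (cases n)
    case 0
    then obtain k where k: "ks = [k]" using Suc.hyps(2) by (auto simp: Suc_length_conv)
    have "pairing (coprod_iter (length ks) H) G = pairing H (\<lambda>\<tau>. G [\<tau>])"
      by (simp add: coprod_iter_def k pairing_tensor1)
    also have "\<dots> = pairing H (\<lambda>\<tau>. if length \<tau> = sum_list ks
      then G (map (\<lambda>e. perm_inv (std e)) (cut_word ks (perm_inv \<tau>))) else 0)"
    proof (rule pairing_cong)
      fix \<tau> assume "\<tau> \<in> Poly_Mapping.keys H"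
      then have "\<tau> \<in> perm_words" using assms(1) by (auto simp: FQSym_def)
      then show "G [\<tau>] = (if length \<tau> = sum_list ks
        then G (map (\<lambda>e. perm_inv (std e)) (cut_word ks (perm_inv \<tau>))) else 0)"
        using Suc.prems(2)[of "[\<tau>]"] by (simp add: k perm_inv_in_perm_words perm_inv_perm_inv)
    qed
    finally show ?thesis .
  next
    case (Suc m)
    then have "length ks = Suc (Suc m)" using Suc.hyps(2) by simp
    then obtain a b ks' where ks: "ks = a # b # ks'"
      by (auto simp: length_Suc_conv)
    define ks'' where "ks'' = (a + b) # ks'"
    define G' where "G' \<rho>s = (if map length \<rho>s = ks'' then
      G (perm_inv (std (take a (perm_inv (hd \<rho>s)))) # perm_inv (std (drop a (perm_inv (hd \<rho>s)))) # tl \<rho>s)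
      else 0)" for \<rho>s
    have "coprod_iter (length ks) H = coprod_first (coprod_iter (length ks'') H)"
      by (simp add: coprod_iter_def ks ks''_def)
    then have "pairing (coprod_iter (length ks) H) G =
      pairing (coprod_iter (length ks'') H) (\<lambda>\<rho>s. \<Sum>(u, v)\<in>{(u, v). u @ v = perm_inv (hd \<rho>s)}.
         G (perm_inv (std u) # perm_inv (std v) # tl \<rho>s))"
      by (simp add: pairing_coprod_first)
    also have "\<dots> = pairing (coprod_iter (length ks'') H) G'"
    proof (rule pairing_cong)
      fix \<rho>s assume "\<rho>s \<in> Poly_Mapping.keys (coprod_iter (length ks'') H)"
      then obtain \<rho> \<rho>s' where \<rho>s: "\<rho>s = \<rho> # \<rho>s'"
        by (cases \<rho>s) (auto simp: in_keys_iff lookup_coprod_iter_Nil)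
      have "(\<Sum>(u, v)\<in>{(u, v). u @ v = perm_inv \<rho>}. G (perm_inv (std u) # perm_inv (std v) # \<rho>s')) =
        (if length (perm_inv \<rho>) = a + b then
          G (perm_inv (std (take a (perm_inv \<rho>))) # perm_inv (std (drop a (perm_inv \<rho>))) # \<rho>s') else 0)"
        by (rule sum_factorizations) (auto intro!: Suc.prems(2) simp: ks)
      also have "\<dots> = G' \<rho>s"
        using Suc.prems(2) by (auto simp: G'_def \<rho>s ks''_def ks)
      finally show "(\<Sum>(u, v)\<in>{(u, v). u @ v = perm_inv (hd \<rho>s)}.
         G (perm_inv (std u) # perm_inv (std v) # tl \<rho>s)) = G' \<rho>s"
        by (simp add: \<rho>s)
    qed
    also have "\<dots> = pairing H (\<lambda>\<tau>. if length \<tau> = sum_list ks''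
      then G' (map (\<lambda>e. perm_inv (std e)) (cut_word ks'' (perm_inv \<tau>))) else 0)"
      using Suc.hyps(2) by (intro Suc.hyps(1)) (auto simp: ks ks''_def G'_def)
    also have "\<dots> = pairing H (\<lambda>\<tau>. if length \<tau> = sum_list ks
      then G (map (\<lambda>e. perm_inv (std e)) (cut_word ks (perm_inv \<tau>))) else 0)"
    proof (rule pairing_cong)
      fix \<tau>
      let ?\<eta> = "perm_inv \<tau>"
      have "G' (map (\<lambda>e. perm_inv (std e)) (cut_word ks'' ?\<eta>)) =
          G (map (\<lambda>e. perm_inv (std e)) (cut_word ks ?\<eta>))" if "length \<tau> = sum_list ks"
      proof -
        have "map length (map (\<lambda>e. perm_inv (std e)) (cut_word ks'' ?\<eta>)) = map length (cut_word ks'' ?\<eta>)"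
          by simp
        also have "\<dots> = ks''" using that by (intro map_length_cut) (simp add: ks ks''_def)
        finally have l: "map length (map (\<lambda>e. perm_inv (std e)) (cut_word ks'' ?\<eta>)) = ks''" .
        have "perm_inv (perm_inv (std (take (a + b) ?\<eta>))) = std (take (a + b) ?\<eta>)"
          by (simp add: perm_inv_perm_inv std_in_perm_words)
        then show ?thesis
          unfolding G'_def if_P[OF l]
          by (simp add: ks ks''_def std_take_std std_drop_std drop_take add.commute min_def)
      qed
      then show "(if length \<tau> = sum_list ks''
          then G' (map (\<lambda>e. perm_inv (std e)) (cut_word ks'' ?\<eta>)) else 0) =
        (if length \<tau> = sum_list ks then G (map (\<lambda>e. perm_inv (std e)) (cut_word ks ?\<eta>)) else 0)"
        by (auto simp: ks ks''_def)
    qed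
    finally show ?thesis .
  qed
qed simp


section \<open>Comparison of the coefficients\<close>

lemma keys_pure_tensor:
  "\<sigma>s \<in> Poly_Mapping.keys (pure_tensor Fs) \<Longrightarrow> list_all2 (\<lambda>\<sigma> F. \<sigma> \<in> Poly_Mapping.keys F) \<sigma>s Fs"
proof (induction Fs arbitrary: \<sigma>s)
  case Nil
  then show ?case by (cases \<sigma>s) (auto simp: in_keys_iff lookup_eq_pairing)
next
  case (Cons F Fs)
  show ?case
  proof (cases \<sigma>s)
    case Nil
    then show ?thesis using Cons.prems by (simp add: in_keys_iff lookup_eq_pairing)
  next
    case (Cons \<sigma> \<sigma>s')
    have "Poly_Mapping.lookup (pure_tensor (F # Fs)) \<sigma>s =
        pairing F (\<lambda>\<rho>. Poly_Mapping.lookup (pure_tensor Fs) \<sigma>s' * (if \<rho> = \<sigma> then 1 else 0))"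
      unfolding lookup_eq_pairing[of "pure_tensor (F # Fs)"] pairing_pure_tensor_Cons Cons
      by (rule pairing_cong) (simp add: lookup_eq_pairing)
    also have "\<dots> = Poly_Mapping.lookup (pure_tensor Fs) \<sigma>s' * Poly_Mapping.lookup F \<sigma>"
      unfolding pairing_fun_scale by (simp add: lookup_eq_pairing)
    finally show ?thesis
      using Cons.prems Cons.IH[of \<sigma>s'] by (simp add: Cons in_keys_iff)
  qed
qed

lemma pos_Cons: "pos (z # w) p = (if z = p then 0 else Suc (pos w p))"
  by (simp add: pos_def)

text \<open>
  An exchange of \<open>x\<close> and \<open>y\<close> alters only the relative position of these two letters, and letters of
  equal colour are never exchanged with each other.
\<close>

lemma pos_less_swap:
  assumes "c x \<noteq> c y" "c p = c q"
  shows "pos (A @ x # y # B) p < pos (A @ x # y # B) q \<longleftrightarrow> pos (A @ y # x # B) p < pos (A @ y # x # B) q"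
  using assms by (induction A) (auto simp: pos_Cons)

lemma std_pos_swap_step:
  assumes "swap_step c u v" "\<And>x y. x \<in> set b \<Longrightarrow> y \<in> set b \<Longrightarrow> c x = c y"
  shows "std (map (\<lambda>x. Suc (pos u x)) b) = std (map (\<lambda>x. Suc (pos v x)) b)"
proof (rule std_cong)
  fix i j
  assume "i < length (map (\<lambda>x. Suc (pos u x)) b)" "j < length (map (\<lambda>x. Suc (pos u x)) b)"
  then have ij: "i < length b" "j < length b" by auto
  have "pos u (b ! i) < pos u (b ! j) \<longleftrightarrow> pos v (b ! i) < pos v (b ! j)" if "i < length b" "j < length b" for i j
    using assms that pos_less_swap[of c _ _ "b ! i" "b ! j"] unfolding swap_step_def by fastforce
  from this[OF ij] this[OF ij(2,1)] show
    "(map (\<lambda>x. Suc (pos u x)) b ! i < map (\<lambda>x. Suc (pos u x)) b ! j \<or>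
      map (\<lambda>x. Suc (pos u x)) b ! i = map (\<lambda>x. Suc (pos u x)) b ! j \<and> i < j) \<longleftrightarrow>
     (map (\<lambda>x. Suc (pos v x)) b ! i < map (\<lambda>x. Suc (pos v x)) b ! j \<or>
      map (\<lambda>x. Suc (pos v x)) b ! i = map (\<lambda>x. Suc (pos v x)) b ! j \<and> i < j)"
    using ij by (auto simp: linorder_neq_iff[of "pos u _"] not_less_iff_gr_or_eq)
qed simp

text \<open>
  Writing \<open>b\<close> as its sorted word rearranged by \<^term>\<open>std b\<close> separates the effect of \<open>f\<close> from the order
  of the letters in \<open>b\<close>. This rewrites a condition on the positions of the letters of a block as a
  condition on the standardization of the block, which is the form in which the product of the
  \<open>G\<^sub>\<beta>\<^sub>i\<close> produces it.
\<close>

lemma std_map_block_iff: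
  fixes b :: "nat list" and f :: "nat \<Rightarrow> nat"
  assumes "distinct b" "inj_on f (set b)" "\<sigma> \<in> perm_words" "length \<sigma> = length b"
  shows "std (map f b) = \<sigma> \<longleftrightarrow> std b = perm_comp (perm_inv (std (map f (sort b)))) \<sigma>"
proof -
  let ?e = "std (map f (sort b))"
  have sb: "set (std b) = {1..length b}" using std_in_perm_words[of b] by (simp add: perm_words_iff)
  have "map f b = map f (perm_comp (sort b) (std b))"
    using assms(1) by (simp add: perm_comp_sort_std)
  also have "\<dots> = perm_comp (map f (sort b)) (std b)"
    using sb by (auto simp: perm_comp_def)
  finally have "std (map f b) = perm_comp ?e (std b)"
    using assms(1,2) by (simp add: std_perm_comp std_in_perm_words distinct_map)
  moreover have "perm_comp (perm_inv ?e) (perm_comp ?e (std b)) = std b"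
    using sb by (intro perm_comp_perm_inv_left std_in_perm_words) simp
  moreover have "perm_comp ?e (perm_comp (perm_inv ?e) \<sigma>) = \<sigma>"
    using assms(3,4) by (intro perm_comp_perm_inv_right std_in_perm_words) (simp add: perm_words_iff)
  ultimately show ?thesis by metis
qed

text \<open>
  The colour of a letter is the number of its block. The three properties say that the
  concatenation of the sorted blocks is the result of sorting its letters stably by colour, starting
  from their increasing arrangement.
\<close>

lemma block_colouring:
  fixes bs :: "nat list list"
  assumes "distinct (concat bs)"
  shows "\<exists>c :: nat \<Rightarrow> nat. sorted (map c (concat (map sort bs))) \<and>
    (\<forall>b\<in>set bs. \<forall>x\<in>set b. \<forall>y\<in>set b. c x = c y) \<and>
    (\<forall>k. sorted (filter (\<lambda>x. c x = k) (concat (map sort bs))))"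
  using assms
proof (induction bs)
  case (Cons b bs)
  then have "distinct (concat bs)" by simp
  from Cons.IH[OF this] obtain c :: "nat \<Rightarrow> nat" where c: "sorted (map c (concat (map sort bs)))"
    "\<forall>b\<in>set bs. \<forall>x\<in>set b. \<forall>y\<in>set b. c x = c y"
    "\<forall>k. sorted (filter (\<lambda>x. c x = k) (concat (map sort bs)))"
    by blast
  let ?rest = "concat (map sort bs)"
  define d where "d x = (if x \<in> set b then 0 else Suc (c x))" for x
  have out: "x \<notin> set b" if "x \<in> set ?rest" for x using Cons.prems that by auto
  then have d_rest: "d x = Suc (c x)" if "x \<in> set ?rest" for x using that by (simp add: d_def)
  have d_b: "d x = 0" if "x \<in> set b" for x using that by (simp add: d_def)
  have "map d ?rest = map Suc (map c ?rest)" using d_rest by simp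
  moreover have "sorted (map Suc ks)" if "sorted ks" for ks using that by (induction ks) auto
  ultimately have "sorted (map d ?rest)" using c(1) by metis
  moreover have "map d (sort b) = replicate (length b) 0"
  proof -
    have "map d (sort b) = map (\<lambda>_. 0) (sort b)" using d_b by simp
    then show ?thesis by (simp add: map_replicate_const)
  qed
  ultimately have "sorted (map d (concat (map sort (b # bs))))"
    by (simp add: sorted_append)
  moreover have "d x = d y" if "b' \<in> set (b # bs)" "x \<in> set b'" "y \<in> set b'" for b' x y
  proof (cases "b' = b")
    case False
    then have b': "b' \<in> set bs" using that(1) by simp
    then have "x \<in> set ?rest" "y \<in> set ?rest" using that(2,3) by auto
    then have "d x = Suc (c x)" "d y = Suc (c y)" by (simp_all only: d_rest)
    moreover have "c x = c y" using c(2) b' that(2,3) by blast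
    ultimately show ?thesis by simp
  qed (use that d_b in simp)
  moreover have "sorted (filter (\<lambda>x. d x = k) (concat (map sort (b # bs))))" for k
  proof (cases k)
    case 0
    then have "filter (\<lambda>x. d x = k) ?rest = []" using d_rest by (simp add: filter_empty_conv)
    then show ?thesis by (simp add: sorted_wrt_filter)
  next
    case (Suc k')
    then have "filter (\<lambda>x. d x = k) ?rest = filter (\<lambda>x. c x = k') ?rest"
      using d_rest by (intro filter_cong) auto
    moreover have "filter (\<lambda>x. d x = k) (sort b) = []" using d_b Suc by (simp add: filter_empty_conv)
    ultimately show ?thesis using c(3) by simp
  qed
  ultimately show ?case by blast
qed simp

text \<open>
  The function \<^const>\<open>pos\<close> counts from 0 and makes sense for every word, whereas \<^const>\<open>perm_inv\<close>
  inverts permutations; both describe \<open>\<tau>\<^sup>-\<^sup>1\<close>.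
\<close>

lemma map_pos_eq_perm_comp:
  assumes "\<tau> \<in> perm_words" "\<gamma> \<in> perm_words" "length \<tau> = length \<gamma>"
  shows "map (\<lambda>x. Suc (pos \<tau> x)) \<gamma> = perm_comp (perm_inv \<tau>) \<gamma>"
  unfolding perm_comp_def using assms
  by (intro map_cong) (simp_all add: nth_perm_inv perm_words_iff[of \<gamma>] del: One_nat_def)

lemma map_pos_in_perm_words:
  assumes "\<tau> \<in> perm_words" "\<gamma> \<in> perm_words" "length \<tau> = length \<gamma>"
  shows "map (\<lambda>x. Suc (pos \<tau> x)) \<gamma> \<in> perm_words"
  using assms by (simp add: map_pos_eq_perm_comp perm_comp_in_perm_words perm_inv_in_perm_words)

text \<open>
  The only \<open>\<xi>\<close> with \<open>\<tau> \<xi> = \<gamma>\<close> is \<open>\<tau>\<^sup>-\<^sup>1 \<gamma>\<close>.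
\<close>

lemma fq_internal_coefficient:
  assumes P: "P \<in> FQSym" and \<tau>: "\<tau> \<in> perm_words" and \<gamma>: "\<gamma> \<in> perm_words" "length \<tau> = length \<gamma>"
  shows "pairing P (\<lambda>\<xi>. if length \<xi> = length \<tau> then if perm_comp \<tau> \<xi> = \<gamma> then 1 else 0 else 0) =
    Poly_Mapping.lookup P (map (\<lambda>x. Suc (pos \<tau> x)) \<gamma>)"
proof -
  have s: "set \<gamma> = {1..length \<tau>}" using \<gamma> by (simp add: perm_words_iff)
  have inv: "map (\<lambda>x. Suc (pos \<tau> x)) \<gamma> = perm_comp (perm_inv \<tau>) \<gamma>"
    using \<tau> \<gamma> by (rule map_pos_eq_perm_comp)
  have iff: "(length \<xi> = length \<tau> \<and> perm_comp \<tau> \<xi> = \<gamma>) \<longleftrightarrow> \<xi> = perm_comp (perm_inv \<tau>) \<gamma>"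
    if "\<xi> \<in> perm_words" for \<xi>
  proof
    assume *: "length \<xi> = length \<tau> \<and> perm_comp \<tau> \<xi> = \<gamma>"
    then show "\<xi> = perm_comp (perm_inv \<tau>) \<gamma>"
      using perm_comp_perm_inv_left[OF \<tau>, of \<xi>] that by (simp add: perm_words_iff)
  next
    assume "\<xi> = perm_comp (perm_inv \<tau>) \<gamma>"
    then show "length \<xi> = length \<tau> \<and> perm_comp \<tau> \<xi> = \<gamma>"
      using perm_comp_perm_inv_right[OF \<tau>, of \<gamma>] s \<gamma>(2) by simp
  qed
  have "pairing P (\<lambda>\<xi>. if length \<xi> = length \<tau> then if perm_comp \<tau> \<xi> = \<gamma> then 1 else 0 else 0) =
      pairing P (\<lambda>\<xi>. if \<xi> = perm_comp (perm_inv \<tau>) \<gamma> then 1 else 0)"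
  proof (rule pairing_cong)
    fix \<xi> assume "\<xi> \<in> Poly_Mapping.keys P"
    then have "\<xi> \<in> perm_words" using P by (auto simp: FQSym_def)
    from iff[OF this] show "(if length \<xi> = length \<tau> then if perm_comp \<tau> \<xi> = \<gamma> then 1 else 0 else 0) =
        (if \<xi> = perm_comp (perm_inv \<tau>) \<gamma> then 1 else (0 :: 'a))"
      by presburger
  qed
  then show ?thesis by (simp add: lookup_eq_pairing inv)
qed

text \<open>
  The first condition on \<open>\<tau>\<close> is that of the left side of the splitting formula, the second that of
  the right side. The first one, as a function of the word \<open>\<tau>\<close>, does not change when letters of
  different blocks commute. Inserting \<open>ys\<close>, the concatenation of the sorted blocks, into \<open>H\<close>
  instead of \<open>1 2 \<dots> n\<close> turns the first condition into the second.
\<close>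

lemma respects_traces_blocks:
  fixes H :: "nat list \<Rightarrow>\<^sub>0 'k::field"
  assumes H: "H \<in> FQSym" "respects_traces H"
    and \<sigma>s: "set \<sigma>s \<subseteq> perm_words" "map length bs = map length \<sigma>s"
    and bs: "concat bs \<in> perm_words"
  shows "pairing H (\<lambda>\<tau>. if length \<tau> = length (concat bs) \<and>
        map (\<lambda>b. std (map (\<lambda>x. Suc (pos \<tau> x)) b)) bs = \<sigma>s then 1 else 0) =
    pairing H (\<lambda>\<tau>. if length \<tau> = length (concat bs) \<and>
        map std bs = map2 (\<lambda>\<sigma> \<tau>. perm_comp \<tau> \<sigma>) \<sigma>s
          (map (\<lambda>e. perm_inv (std e)) (cut_word (map length bs) (perm_inv \<tau>))) then 1 else 0)"
proof -
  let ?N = "length (concat bs)"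
  define \<Phi> :: "nat list \<Rightarrow> 'k" where
    "\<Phi> w = (if map (\<lambda>b. std (map (\<lambda>x. Suc (pos w x)) b)) bs = \<sigma>s then 1 else 0)" for w
  define ys where "ys = concat (map sort bs)"
  have dbs: "distinct (concat bs)" and sbs: "set (concat bs) = {1..?N}"
    using bs by (simp_all only: perm_words_iff)
  have mys: "mset ys = mset (concat bs)" unfolding ys_def by (induction bs) auto
  have ys: "distinct ys" "set ys = {1..?N}" "length ys = ?N"
    using dbs sbs mys mset_eq_imp_distinct_iff mset_eq_setD mset_eq_length by metis+
  obtain c :: "nat \<Rightarrow> nat" where c: "sorted (map c ys)"
    "\<forall>b\<in>set bs. \<forall>x\<in>set b. \<forall>y\<in>set b. c x = c y" "\<forall>k. sorted (filter (\<lambda>x. c x = k) ys)"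
    using block_colouring[OF dbs] unfolding ys_def by blast
  have inv: "trace_invariant c \<Phi>"
    unfolding trace_invariant_def
  proof (intro allI impI)
    fix u v assume "swap_step c u v"
    then have "map (\<lambda>b. std (map (\<lambda>x. Suc (pos u x)) b)) bs = map (\<lambda>b. std (map (\<lambda>x. Suc (pos v x)) b)) bs"
    proof (intro map_cong refl std_pos_swap_step)
      fix b x y assume "b \<in> set bs" "x \<in> set b" "y \<in> set b"
      then show "c x = c y" using c(2) by blast
    qed
    then show "\<Phi> u = \<Phi> v" by (simp only: \<Phi>_def)
  qed
  \<comment> \<open>Stable sorting by block leaves the letters of each block in increasing order.\<close>
  have "sort_key c [1..<Suc ?N] = ys"
  proof (rule properties_for_sort_key)
    have "mset ys = mset [1..<Suc ?N]"
    proof (rule set_eq_iff_mset_eq_distinct[THEN iffD1])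
      show "set ys = set [1..<Suc ?N]" using ys by (simp only: set_upt atLeastLessThanSuc_atLeastAtMost)
    qed (use ys in simp_all)
    then show "mset ys = mset [1..<Suc ?N]" .
    show "filter (\<lambda>x. c k = c x) ys = filter (\<lambda>x. c k = c x) [1..<Suc ?N]" for k
    proof (rule sorted_distinct_set_unique)
      have "(\<lambda>x. c k = c x) = (\<lambda>x. c x = c k)" by auto
      then show "sorted (filter (\<lambda>x. c k = c x) ys)" using c(3) by simp
      show "sorted (filter (\<lambda>x. c k = c x) [1..<Suc ?N])" by (intro sorted_wrt_filter sorted_upt)
      show "set (filter (\<lambda>x. c k = c x) ys) = set (filter (\<lambda>x. c k = c x) [1..<Suc ?N])"
        using ys by (simp only: set_filter set_upt atLeastLessThanSuc_atLeastAtMost)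
    qed (use ys in simp_all)
  qed (rule c)
  with swap_steps_sort_key[of c "[1..<Suc ?N]"]
  have steps: "(swap_step c)\<^sup>*\<^sup>* [1..<Suc ?N] ys" by simp
  have "pairing H (\<lambda>\<tau>. if length \<tau> = ?N \<and>
        map (\<lambda>b. std (map (\<lambda>x. Suc (pos \<tau> x)) b)) bs = \<sigma>s then 1 else 0) = substitute H [1..<Suc ?N] \<Phi>"
    unfolding substitute_def
  proof (rule pairing_cong)
    fix \<tau> assume "\<tau> \<in> Poly_Mapping.keys H"
    then have "set \<tau> = {1..length \<tau>}" using H(1) by (auto simp: FQSym_def perm_words_iff)
    then have "perm_comp [1..<Suc ?N] \<tau> = \<tau>" if "length \<tau> = ?N"
      using that by (intro upt_perm_comp) simp
    moreover have "length [1..<Suc ?N] = ?N" by (simp del: upt_Suc)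
    ultimately show "(if length \<tau> = ?N \<and> map (\<lambda>b. std (map (\<lambda>x. Suc (pos \<tau> x)) b)) bs = \<sigma>s then 1 else 0) =
      (if length \<tau> = length [1..<Suc ?N] then \<Phi> (perm_comp [1..<Suc ?N] \<tau>) else 0)"
      by (simp only: \<Phi>_def) simp
  qed
  also have "\<dots> = substitute H ys \<Phi>"
    using steps H(2) inv by (rule respects_traces_steps)
  also have "\<dots> = pairing H (\<lambda>\<tau>. if length \<tau> = ?N \<and>
        map std bs = map2 (\<lambda>\<sigma> \<tau>. perm_comp \<tau> \<sigma>) \<sigma>s
          (map (\<lambda>e. perm_inv (std e)) (cut_word (map length bs) (perm_inv \<tau>))) then 1 else 0)"
    unfolding substitute_def
  proof (rule pairing_cong)
    fix \<tau> assume "\<tau> \<in> Poly_Mapping.keys H"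
    then have \<tau>: "\<tau> \<in> perm_words" using H(1) by (auto simp: FQSym_def)
    have "(map (\<lambda>b. std (map (\<lambda>x. Suc (pos (perm_comp ys \<tau>) x)) b)) bs = \<sigma>s) \<longleftrightarrow>
      map std bs = map2 (\<lambda>\<sigma> \<tau>. perm_comp \<tau> \<sigma>) \<sigma>s
          (map (\<lambda>e. perm_inv (std e)) (cut_word (map length bs) (perm_inv \<tau>)))"
      if len: "length \<tau> = ?N"
    proof -
      let ?w = "perm_comp ys \<tau>"
      let ?f = "\<lambda>x. Suc (pos ?w x)"
      let ?y = "\<lambda>z. ys ! (z - 1)"
      have set\<tau>: "set \<tau> = {1..?N}" using \<tau> len by (simp add: perm_words_iff)
      have inj: "inj_on ?y {1..?N}"
        using ys by (auto simp: inj_on_def nth_eq_iff_index_eq)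
      have "pos ?w (?y z) = pos \<tau> z" if "z \<in> {1..?N}" for z
        unfolding perm_comp_def using that inj by (intro pos_map) (simp add: set\<tau> insert_absorb)
      then have "map ?f (map ?y [1..<Suc ?N]) = map (\<lambda>x. Suc (pos \<tau> x)) [1..<Suc ?N]"
        by (simp del: upt_Suc One_nat_def add: atLeastLessThanSuc_atLeastAtMost)
      moreover have "map ?y [1..<Suc ?N] = ys"
        using perm_comp_upt[of ys] by (simp only: perm_comp_def ys(3))
      ultimately have "perm_inv \<tau> = map ?f ys"
        by (simp only: perm_inv_eq[OF \<tau>] len)
      also have "cut_word (map length bs) \<dots> = map (map ?f) (map sort bs)"
        using cut_concat[of "map sort bs"] by (simp add: cut_map ys_def o_def)
      \<comment> \<open>Inserting \<open>ys\<close> renames the letters, so the \<open>i\<close>-th part of \<open>\<tau>\<^sup>-\<^sup>1\<close> lists the positions, in the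
        renamed word, of the letters of the \<open>i\<close>-th block in increasing order of the letters.\<close>
      finally have cut_word: "cut_word (map length bs) (perm_inv \<tau>) = map (\<lambda>b. map ?f (sort b)) bs"
        by (simp add: o_def)
      have "set ?w = {1..?N}" using set_perm_comp[OF \<tau>, of ys] ys len by simp
      then have inj_pos: "inj_on ?f {1..?N}" by (intro inj_onI) (metis Suc_inject nth_pos)
      have block: "std (map ?f b) = \<sigma> \<longleftrightarrow> std b = perm_comp (perm_inv (std (map ?f (sort b)))) \<sigma>"
        if "b \<in> set bs" "\<sigma> \<in> perm_words" "length b = length \<sigma>" for b \<sigma>
      proof (intro std_map_block_iff)
        show "distinct b" using dbs that(1) by (auto simp: distinct_concat_iff)
        have "set b \<subseteq> {1..?N}" using sbs that(1) by auto
        with inj_pos show "inj_on ?f (set b)" by (rule inj_on_subset)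
      qed (use that in auto)
      have "length bs = length \<sigma>s" using \<sigma>s(2) by (metis length_map)
      then have "(map (\<lambda>b. std (map ?f b)) bs = \<sigma>s) \<longleftrightarrow>
        map std bs = map2 (\<lambda>\<sigma> \<tau>. perm_comp \<tau> \<sigma>) \<sigma>s (map (\<lambda>b. perm_inv (std (map ?f (sort b)))) bs)"
        using \<sigma>s block
      proof (induction bs \<sigma>s rule: list_induct2)
        case (Cons b bs \<sigma> \<sigma>s)
        have "std (map ?f b) = \<sigma> \<longleftrightarrow> std b = perm_comp (perm_inv (std (map ?f (sort b)))) \<sigma>"
          using Cons.prems by simp
        moreover have "(map (\<lambda>b. std (map ?f b)) bs = \<sigma>s) \<longleftrightarrow>
          map std bs = map2 (\<lambda>\<sigma> \<tau>. perm_comp \<tau> \<sigma>) \<sigma>s (map (\<lambda>b. perm_inv (std (map ?f (sort b)))) bs)"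
          using Cons.prems by (intro Cons.IH) simp_all
        ultimately show ?case by simp
      qed simp
      then show ?thesis by (simp add: cut_word o_def)
    qed
    then show "(if length \<tau> = length ys then \<Phi> (perm_comp ys \<tau>) else 0) =
      (if length \<tau> = ?N \<and> map std bs = map2 (\<lambda>\<sigma> \<tau>. perm_comp \<tau> \<sigma>) \<sigma>s
          (map (\<lambda>e. perm_inv (std e)) (cut_word (map length bs) (perm_inv \<tau>))) then 1 else 0)"
      by (simp add: \<Phi>_def ys(3))
  qed
  finally show ?thesis .
qed

text \<open>
  The coefficient of \<open>\<gamma>\<close> on both sides of the splitting formula for \<open>F\<^sub>i = G\<^sub>\<sigma>\<^sub>i\<close>, expressed by the
  coefficients of products of basis elements.
\<close>

lemma splitting_coefficient:
  fixes H :: "nat list \<Rightarrow>\<^sub>0 'k::field"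
  assumes H: "H \<in> FQSym" "respects_traces H" and \<sigma>s: "set \<sigma>s \<subseteq> perm_words" and \<gamma>: "\<gamma> \<in> perm_words"
  defines "ks \<equiv> map length \<sigma>s"
  shows "pairing H (\<lambda>\<tau>. if length \<tau> = length \<gamma>
      then Poly_Mapping.lookup (fq_prod (map bG \<sigma>s)) (map (\<lambda>x. Suc (pos \<tau> x)) \<gamma>) else 0) =
    pairing H (\<lambda>\<tau>. if length \<tau> = sum_list ks
      then Poly_Mapping.lookup (fq_prod (map bG (map2 (\<lambda>\<sigma> \<tau>. perm_comp \<tau> \<sigma>) \<sigma>s
        (map (\<lambda>e. perm_inv (std e)) (cut_word ks (perm_inv \<tau>)))))) \<gamma> else 0)"
    (is "?L = ?R")
proof -
  have lens: "map length (map2 (\<lambda>\<sigma> \<tau>. perm_comp \<tau> \<sigma>) \<sigma>s \<tau>s) = ks" if "length \<tau>s = length \<sigma>s" for \<tau>s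
    unfolding ks_def using that by (induction \<tau>s \<sigma>s rule: list_induct2) simp_all
  have len_ks: "length ks = length \<sigma>s" by (simp add: ks_def)
  show ?thesis
  proof (cases "sum_list ks = length \<gamma>")
    case False
    have "?L = pairing H (\<lambda>_. 0)"
    proof (rule pairing_cong)
      fix \<tau> assume "\<tau> \<in> Poly_Mapping.keys H"
      then have "\<tau> \<in> perm_words" using H(1) by (auto simp: FQSym_def)
      then show "(if length \<tau> = length \<gamma> then Poly_Mapping.lookup (fq_prod (map bG \<sigma>s))
          (map (\<lambda>x. Suc (pos \<tau> x)) \<gamma>) else 0) = (0::'k)"
        using False \<gamma> by (simp add: lookup_fq_prod map_pos_in_perm_words flip: ks_def)
    qed
    moreover have "?R = pairing H (\<lambda>_. 0)"
      by (rule pairing_cong) (simp add: lookup_fq_prod[OF \<gamma>] lens len_ks False del: map_map)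
    ultimately show ?thesis by simp
  next
    case True
    define bs where "bs = cut_word ks \<gamma>"
    have bs: "concat bs = \<gamma>" "map length bs = ks"
      using True by (simp_all add: bs_def concat_cut map_length_cut)
    have "?L = pairing H (\<lambda>\<tau>. if length \<tau> = length (concat bs) \<and>
        map (\<lambda>b. std (map (\<lambda>x. Suc (pos \<tau> x)) b)) bs = \<sigma>s then 1 else 0)"
    proof (rule pairing_cong)
      fix \<tau> assume "\<tau> \<in> Poly_Mapping.keys H"
      then have "\<tau> \<in> perm_words" using H(1) by (auto simp: FQSym_def)
      then show "(if length \<tau> = length \<gamma> then Poly_Mapping.lookup (fq_prod (map bG \<sigma>s))
          (map (\<lambda>x. Suc (pos \<tau> x)) \<gamma>) else 0) =
        (if length \<tau> = length (concat bs) \<and>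
          map (\<lambda>b. std (map (\<lambda>x. Suc (pos \<tau> x)) b)) bs = \<sigma>s then 1 else (0::'k))"
        using \<gamma> True
        by (simp add: lookup_fq_prod map_pos_in_perm_words cut_map o_def bs(1) flip: ks_def bs_def)
    qed
    also have "\<dots> = pairing H (\<lambda>\<tau>. if length \<tau> = length (concat bs) \<and>
        map std bs = map2 (\<lambda>\<sigma> \<tau>. perm_comp \<tau> \<sigma>) \<sigma>s
          (map (\<lambda>e. perm_inv (std e)) (cut_word (map length bs) (perm_inv \<tau>))) then 1 else 0)"
      using H \<sigma>s bs \<gamma> by (intro respects_traces_blocks) (simp_all add: ks_def)
    also have "\<dots> = ?R"
      by (rule pairing_cong)
        (simp add: lookup_fq_prod[OF \<gamma>] lens len_ks True bs(1) bs(2) flip: bs_def del: map_map)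
    finally show ?thesis .
  qed
qed

theorem proposition7p2:
  fixes r :: nat
    and Fs :: "(nat list \<Rightarrow>\<^sub>0 'k::field_char_0) list"
    and H :: "nat list \<Rightarrow>\<^sub>0 'k"
  assumes "r \<ge> 1"
    and "length Fs = r"
    and "set Fs \<subseteq> FQSym"
    and "H \<in> PR_algebra"
  shows "fq_internal (fq_prod Fs) H = mu (tensor_internal (pure_tensor Fs) (coprod_iter r H))"
proof (rule poly_mapping_eqI)
  fix \<gamma> :: "nat list"
  have H: "H \<in> FQSym" "respects_traces H"
    using assms(4) by (simp_all add: PR_algebra_FQSym PR_algebra_respects_traces)
  let ?\<delta> = "\<lambda>x. if x = \<gamma> then 1 else (0 :: 'k)"
  have left: "Poly_Mapping.lookup (fq_internal (fq_prod Fs) H) \<gamma> =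
    pairing (pure_tensor Fs) (\<lambda>\<sigma>s. pairing (fq_prod (map bG \<sigma>s)) (\<lambda>\<xi>. pairing H (\<lambda>\<tau>.
      if length \<xi> = length \<tau> then ?\<delta> (perm_comp \<tau> \<xi>) else 0)))"
    unfolding lookup_eq_pairing pairing_fq_internal by (rule pairing_fq_prod)
  have right: "Poly_Mapping.lookup (mu (tensor_internal (pure_tensor Fs) (coprod_iter r H))) \<gamma> =
    pairing (pure_tensor Fs) (\<lambda>\<sigma>s. pairing (coprod_iter r H) (\<lambda>\<tau>s. if map length \<tau>s = map length \<sigma>s
      then Poly_Mapping.lookup (fq_prod (map bG (map2 (\<lambda>\<sigma> \<tau>. perm_comp \<tau> \<sigma>) \<sigma>s \<tau>s))) \<gamma> else 0))"
    unfolding lookup_eq_pairing pairing_mu pairing_tensor_internal ..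
  show "Poly_Mapping.lookup (fq_internal (fq_prod Fs) H) \<gamma> =
    Poly_Mapping.lookup (mu (tensor_internal (pure_tensor Fs) (coprod_iter r H))) \<gamma>"
    unfolding left right
  proof (rule pairing_cong)
    fix \<sigma>s assume "\<sigma>s \<in> Poly_Mapping.keys (pure_tensor Fs)"
    then have \<sigma>s_Fs: "list_all2 (\<lambda>\<sigma> F. \<sigma> \<in> Poly_Mapping.keys F) \<sigma>s Fs" by (rule keys_pure_tensor)
    then have len: "length \<sigma>s = r" using assms(2) by (simp add: list_all2_lengthD)
    from \<sigma>s_Fs assms(3) have \<sigma>s: "set \<sigma>s \<subseteq> perm_words"
      by (induction rule: list_all2_induct) (auto simp: FQSym_def)
    let ?ks = "map length \<sigma>s"
    let ?P = "fq_prod (map bG \<sigma>s) :: nat list \<Rightarrow>\<^sub>0 'k"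
    let ?R = "\<lambda>\<tau>s. Poly_Mapping.lookup (fq_prod (map bG (map2 (\<lambda>\<sigma> \<tau>. perm_comp \<tau> \<sigma>) \<sigma>s \<tau>s))) \<gamma> :: 'k"
    let ?blocks = "\<lambda>\<tau>. map (\<lambda>e. perm_inv (std e)) (cut_word ?ks (perm_inv \<tau>))"
    have not_perm: "Poly_Mapping.lookup (fq_prod Gs) \<gamma> = 0" if "\<gamma> \<notin> perm_words"
      for Gs :: "(nat list \<Rightarrow>\<^sub>0 'k) list"
      using that fq_prod_in_FQSym[of Gs] by (auto simp: FQSym_def in_keys_iff)
    have "pairing ?P (\<lambda>\<xi>. pairing H (\<lambda>\<tau>. if length \<xi> = length \<tau> then ?\<delta> (perm_comp \<tau> \<xi>) else 0)) =
      pairing H (\<lambda>\<tau>. pairing ?P (\<lambda>\<xi>. if length \<xi> = length \<tau> then ?\<delta> (perm_comp \<tau> \<xi>) else 0))"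
      by (rule pairing_swap)
    also have "\<dots> = pairing H (\<lambda>\<tau>. if length \<tau> = sum_list ?ks then ?R (?blocks \<tau>) else 0)"
    proof (cases "\<gamma> \<in> perm_words")
      case True
      have "pairing H (\<lambda>\<tau>. pairing ?P (\<lambda>\<xi>. if length \<xi> = length \<tau> then ?\<delta> (perm_comp \<tau> \<xi>) else 0)) =
        pairing H (\<lambda>\<tau>. if length \<tau> = length \<gamma>
          then Poly_Mapping.lookup ?P (map (\<lambda>x. Suc (pos \<tau> x)) \<gamma>) else 0)"
      proof (rule pairing_cong)
        fix \<tau> assume "\<tau> \<in> Poly_Mapping.keys H"
        then have \<tau>: "\<tau> \<in> perm_words" using H(1) by (auto simp: FQSym_def)
        show "pairing ?P (\<lambda>\<xi>. if length \<xi> = length \<tau> then ?\<delta> (perm_comp \<tau> \<xi>) else 0) =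
          (if length \<tau> = length \<gamma> then Poly_Mapping.lookup ?P (map (\<lambda>x. Suc (pos \<tau> x)) \<gamma>) else 0)"
        proof (cases "length \<tau> = length \<gamma>")
          case len: True
          show ?thesis
            using fq_internal_coefficient[OF fq_prod_in_FQSym \<tau> True len] len by simp
        next
          case False
          then have "pairing ?P (\<lambda>\<xi>. if length \<xi> = length \<tau> then ?\<delta> (perm_comp \<tau> \<xi>) else 0) =
              pairing ?P (\<lambda>_. 0)"
            by (intro pairing_cong) (auto simp: perm_comp_def)
          with False show ?thesis by simp
        qed
      qed
      also have "\<dots> = pairing H (\<lambda>\<tau>. if length \<tau> = sum_list ?ks then ?R (?blocks \<tau>) else 0)"
        using H \<sigma>s True by (rule splitting_coefficient)
      finally show ?thesis .
    next
      case False
      have "pairing H (\<lambda>\<tau>. pairing ?P (\<lambda>\<xi>. if length \<xi> = length \<tau> then ?\<delta> (perm_comp \<tau> \<xi>) else 0)) =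
        pairing H (\<lambda>\<tau>. 0)"
      proof (rule pairing_cong)
        fix \<tau> assume "\<tau> \<in> Poly_Mapping.keys H"
        then have "\<tau> \<in> perm_words" using H(1) by (auto simp: FQSym_def)
        moreover have "\<xi> \<in> perm_words" if "\<xi> \<in> Poly_Mapping.keys ?P" for \<xi>
          using that fq_prod_in_FQSym[of "map bG \<sigma>s"] by (auto simp: FQSym_def)
        ultimately have "pairing ?P (\<lambda>\<xi>. if length \<xi> = length \<tau> then ?\<delta> (perm_comp \<tau> \<xi>) else 0) =
            pairing ?P (\<lambda>_. 0)"
          using False by (intro pairing_cong) (auto dest: perm_comp_in_perm_words)
        then show "pairing ?P (\<lambda>\<xi>. if length \<xi> = length \<tau> then ?\<delta> (perm_comp \<tau> \<xi>) else 0) = 0"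
          by simp
      qed
      then show ?thesis by (simp add: not_perm[OF False] del: map_map cong: if_cong)
    qed
    also have "\<dots> = pairing H (\<lambda>\<tau>. if length \<tau> = sum_list ?ks
        then (if map length (?blocks \<tau>) = ?ks then ?R (?blocks \<tau>) else 0) else 0)"
    proof (rule pairing_cong)
      fix \<tau>
      have "map length (?blocks \<tau>) = ?ks" if "length \<tau> = sum_list ?ks"
        using map_length_cut[of ?ks "perm_inv \<tau>"] that by (simp add: o_def)
      then show "(if length \<tau> = sum_list ?ks then ?R (?blocks \<tau>) else 0) =
        (if length \<tau> = sum_list ?ks
          then (if map length (?blocks \<tau>) = ?ks then ?R (?blocks \<tau>) else 0) else 0)"
        by simp
    qed
    also have "\<dots> = pairing (coprod_iter (length ?ks) H)
        (\<lambda>\<tau>s. if map length \<tau>s = ?ks then ?R \<tau>s else 0)"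
      by (rule pairing_coprod_iter[symmetric]) (use H len assms(1) in auto)
    finally show "pairing ?P (\<lambda>\<xi>. pairing H (\<lambda>\<tau>. if length \<xi> = length \<tau> then ?\<delta> (perm_comp \<tau> \<xi>) else 0)) =
      pairing (coprod_iter r H) (\<lambda>\<tau>s. if map length \<tau>s = ?ks then ?R \<tau>s else 0)"
      by (simp add: len)
  qed
qed

end
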